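(* For every $p\in\mathbb{N}^{\mathbb{N}}$ and $n\in\mathbb{N}$, let $A^p_n=\{k<n : (\exists^\infty j)\; p(j)=k\}$. For every $n>0$, let $g_n:\mathbb{N}^{\mathbb{N}}\rightrightarrows\mathbb{N}^{\mathbb{N}}$ be the total problem defined by $$g_n(p)=\begin{cases}\{0^{\sigma(0)}1^{\sigma(1)}\cdots(m-1)^{\sigma(m-1)}m^{\mathbb{N}} : \sigma\in\mathbb{N}^m\} & \text{if } A^p_n\neq\emptyset\text{ and } m=\min A^p_n,\\ \{0^{\sigma(0)}1^{\sigma(1)}\cdots(n-1)^{\sigma(n-1)}n^{\mathbb{N}} : \sigma\in\mathbb{N}^n\} & \text{if } A^p_n=\emptyset.\end{cases}$$ Then for every $n>0$, $\mathsf{tJ}^n(\mathrm{id})\equiv_{\mathrm W} g_n$, where $\mathsf{tJ}^n$ is the $n$-fold iterate of the tot-jump and $\mathrm{id}$ is the identity on $\mathbb{N}^{\mathbb{N}}$.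
   Context: A problem is a partial multi-valued function $f:\subseteq\mathbb{N}^{\mathbb{N}}\rightrightarrows\mathbb{N}^{\mathbb{N}}$, with $\mathrm{dom}(f)=\{p: f(p)\ne\emptyset\}$. $f\le_{\mathrm W} g$ means there are partial computable functionals $\Phi:\subseteq\mathbb{N}^{\mathbb{N}}\to\mathbb{N}^{\mathbb{N}}$ and $\Psi:\subseteq\mathbb{N}^{\mathbb{N}}\times\mathbb{N}^{\mathbb{N}}\to\mathbb{N}^{\mathbb{N}}$ such that for every $p\in\mathrm{dom}(f)$: $\Phi(p)\in\mathrm{dom}(g)$ and $\Psi(p,q)\in f(p)$ for every $q\in g(\Phi(p))$. $f\equiv_{\mathrm W} g$ means $f\le_{\mathrm W} g$ and $g\le_{\mathrm W} f$. Finite products of copies of $\mathbb{N}$ and $\mathbb{N}^{\mathbb{N}}$ are identified with $\mathbb{N}^{\mathbb{N}}$ via standard computable codings. $(\Phi_e)_{e\in\mathbb{N}}$ is a fixed standard computable enumeration of the partial computable functionals on $\mathbb{N}^{\mathbb{N}}$; $\Phi_i(p,q)$ means $\Phi_i$ applied to the pair $(p,q)$; $\downarrow$ means defined. Tot-jump: for $e,i\in\mathbb{N}$, $p\in\mathbb{N}^{\mathbb{N}}$, $\mathsf{tJ}(f)(e,i,p)=\{\Phi_i(p,q): q\in f(\Phi_e(p))\}$ if $\Phi_e(p)\in\mathrm{dom}(f)$ and $\Phi_i(p,q)\downarrow$ for all $q\in f(\Phi_e(p))$; otherwise $\mathsf{tJ}(f)(e,i,p)=\mathbb{N}^{\mathbb{N}}$.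 Notation: $\exists^\infty j$ means "there are infinitely many $j$"; $k^{s}$ is the string of $s$ copies of $k$, $k^{\mathbb{N}}$ is the infinite constant sequence $k$, and juxtaposition is concatenation. *)

theory Defs
  imports Main "HOL-Library.Nat_Bijection" "HOL-Library.Omega_Words_Fun"
begin

type_synonym baire = "nat \<Rightarrow> nat"

text \<open>
  Programs for the unary partial recursive functions relative to an oracle. Several arguments
  are combined into one by the Cantor pairing function \<^const>\<open>prod_encode\<close>.
\<close>

datatype prog =
    Zero
  | Succ
  | Fst
  | Snd
  | Oracle
  | Pair prog prog
  | Comp prog prog
  | Prec prog prog
  | Mu prog

text \<open>\<open>eval p c x y\<close>: with oracle \<open>p\<close>, program \<open>c\<close> halts on input \<open>x\<close> with output \<open>y\<close>.\<close>

inductive eval :: "baire \<Rightarrow> prog \<Rightarrow> nat \<Rightarrow> nat \<Rightarrow> bool" for p :: baire where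
  Zero: "eval p Zero x 0"
| Succ: "eval p Succ x (Suc x)"
| Fst: "eval p Fst x (fst (prod_decode x))"
| Snd: "eval p Snd x (snd (prod_decode x))"
| Oracle: "eval p Oracle x (p x)"
| Pair: "eval p a x y \<Longrightarrow> eval p b x z \<Longrightarrow> eval p (Pair a b) x (prod_encode (y, z))"
| Comp: "eval p b x y \<Longrightarrow> eval p a y z \<Longrightarrow> eval p (Comp a b) x z"
| Prec_0: "eval p a x y \<Longrightarrow> eval p (Prec a b) (prod_encode (x, 0)) y"
| Prec_Suc: "eval p (Prec a b) (prod_encode (x, k)) y \<Longrightarrow>
    eval p b (prod_encode (x, prod_encode (k, y))) z \<Longrightarrow>
    eval p (Prec a b) (prod_encode (x, Suc k)) z"
| Mu: "eval p a (prod_encode (x, k)) 0 \<Longrightarrow>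
    (\<forall>j<k. \<exists>y. eval p a (prod_encode (x, j)) (Suc y)) \<Longrightarrow>
    eval p (Mu a) x k"

lemma eval_deterministic: "eval p c x y \<Longrightarrow> eval p c x z \<Longrightarrow> y = z"
proof (induction arbitrary: z rule: eval.induct)
  case (Pair a x y b z')
  from Pair.prems Pair.IH show ?case by (cases rule: eval.cases) auto
next
  case (Comp b x y a z')
  from Comp.prems Comp.IH show ?case by (cases rule: eval.cases) auto
next
  case (Prec_0 a x y b)
  from Prec_0.prems Prec_0.IH show ?case by (cases rule: eval.cases) auto
next
  case (Prec_Suc a b x k y z')
  from Prec_Suc.prems show ?case
    by (cases rule: eval.cases) (use Prec_Suc.IH in auto)
next
  case (Mu a x k)
  from Mu.prems show ?case
  proof (cases rule: eval.cases)
    case Mu2: Mu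
    have "\<not> k < z" using Mu2 Mu.IH(1) by blast
    moreover have "\<not> z < k" using Mu2 Mu.IH(2) by blast
    ultimately show ?thesis by simp
  qed
qed (auto elim: eval.cases)

text \<open>
  The functional computed by a program is defined at \<open>p\<close> iff the program, with oracle \<open>p\<close>,
  halts on every input.
\<close>

definition functional :: "prog \<Rightarrow> baire \<Rightarrow> baire option" where
  "functional c p =
    (if \<forall>n. \<exists>y. eval p c n y then Some (\<lambda>n. THE y. eval p c n y) else None)"

lemma functional_eq_Some_iff: "functional c p = Some q \<longleftrightarrow> (\<forall>n. eval p c n (q n))"
proof
  assume q: "functional c p = Some q"
  show "\<forall>n. eval p c n (q n)"
  proof
    fix n
    from q have "\<exists>y. eval p c n y" and "q n = (THE y. eval p c n y)"
      by (auto simp: functional_def split: if_splits)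
    then show "eval p c n (q n)"
      using eval_deterministic theI[of "eval p c n"] by metis
  qed
next
  assume "\<forall>n. eval p c n (q n)"
  then have "(THE y. eval p c n y) = q n" for n
    using eval_deterministic by blast
  with \<open>\<forall>n. eval p c n (q n)\<close> show "functional c p = Some q"
    by (auto simp: functional_def)
qed

primrec prog_encode :: "prog \<Rightarrow> nat" where
  "prog_encode Zero = 0"
| "prog_encode Succ = 1"
| "prog_encode Fst = 2"
| "prog_encode Snd = 3"
| "prog_encode Oracle = 4"
| "prog_encode (Pair a b) = 4 * prod_encode (prog_encode a, prog_encode b) + 5"
| "prog_encode (Comp a b) = 4 * prod_encode (prog_encode a, prog_encode b) + 6"
| "prog_encode (Prec a b) = 4 * prod_encode (prog_encode a, prog_encode b) + 7"
| "prog_encode (Mu a) = 4 * prog_encode a + 8"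

lemma bij_prog_encode: "bij prog_encode"
proof (rule bijI)
  show "inj prog_encode"
  proof (rule injI)
    fix c d
    show "prog_encode c = prog_encode d \<Longrightarrow> c = d"
      by (induction c arbitrary: d; case_tac d; simp; presburger?)
  qed
  have "\<exists>c. prog_encode c = n" for n
  proof (induction n rule: less_induct)
    case (less n)
    show ?case
    proof (cases "n < 5")
      case True
      then have "n = 0 \<or> n = 1 \<or> n = 2 \<or> n = 3 \<or> n = 4" by auto
      then show ?thesis
        using prog_encode.simps(1-5) by metis
    next
      case False
      define m where "m = (n - 5) div 4"
      obtain a b where ab: "m = prod_encode (a, b)"
        by (metis prod_decode_inverse surj_pair)
      have m: "n = 4 * m + 5 \<or> n = 4 * m + 6 \<or> n = 4 * m + 7 \<or> n = 4 * m + 8"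
        unfolding m_def using False by presburger
      have "a < n" "b < n" "m < n"
        using m le_prod_encode_1[of a b] le_prod_encode_2[of b a] ab by auto
      then obtain c d e where "prog_encode c = a" "prog_encode d = b" "prog_encode e = m"
        using less by metis
      then show ?thesis
        using m ab prog_encode.simps(6-9) by metis
    qed
  qed
  then show "surj prog_encode" by (metis surjI)
qed

definition Phi :: "nat \<Rightarrow> baire \<Rightarrow> baire option" where
  "Phi e = functional (inv prog_encode e)"

definition pair :: "baire \<Rightarrow> baire \<Rightarrow> baire" where
  "pair p q = (\<lambda>n. if even n then p (n div 2) else q (n div 2))"

definition computable :: "(baire \<Rightarrow> baire option) \<Rightarrow> bool" where
  "computable F \<longleftrightarrow> (\<exists>c. F = functional c)"

definition computable2 :: "(baire \<Rightarrow> baire \<Rightarrow> baire option) \<Rightarrow> bool" where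
  "computable2 F \<longleftrightarrow> (\<exists>G. computable G \<and> (\<forall>p q. F p q = G (pair p q)))"

type_synonym problem = "baire \<Rightarrow> baire set"

definition pdom :: "problem \<Rightarrow> baire set" where
  "pdom f = {p. f p \<noteq> {}}"

definition weihrauch_le :: "problem \<Rightarrow> problem \<Rightarrow> bool"  (infix \<open>\<le>\<^sub>W\<close> 50) where
  "f \<le>\<^sub>W g \<longleftrightarrow> (\<exists>F G. computable F \<and> computable2 G \<and>
    (\<forall>p\<in>pdom f. \<exists>p'. F p = Some p' \<and> p' \<in> pdom g \<and>
      (\<forall>q\<in>g p'. \<exists>r. G p q = Some r \<and> r \<in> f p)))"

definition weihrauch_equiv :: "problem \<Rightarrow> problem \<Rightarrow> bool"  (infix \<open>\<equiv>\<^sub>W\<close> 50) where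
  "f \<equiv>\<^sub>W g \<longleftrightarrow> f \<le>\<^sub>W g \<and> g \<le>\<^sub>W f"

definition id_problem :: problem where
  "id_problem p = {p}"

definition tot_jump_at :: "problem \<Rightarrow> nat \<Rightarrow> nat \<Rightarrow> baire \<Rightarrow> baire set" where
  "tot_jump_at f e i p =
    (if \<exists>p'. Phi e p = Some p' \<and> p' \<in> pdom f \<and> (\<forall>q\<in>f p'. Phi i (pair p q) \<noteq> None)
     then {r. \<exists>q\<in>f (the (Phi e p)). Phi i (pair p q) = Some r}
     else UNIV)"

text \<open>The input \<open>(e, i, p)\<close> is coded as the sequence \<open>e, i, p 0, p 1, \<dots>\<close>.\<close>

definition tot_jump :: "problem \<Rightarrow> problem" where
  "tot_jump f r = tot_jump_at f (r 0) (r 1) (\<lambda>n. r (n + 2))"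

definition inf_often :: "baire \<Rightarrow> nat \<Rightarrow> nat set" where
  "inf_often p n = {k. k < n \<and> (\<exists>\<^sub>\<infinity>j. p j = k)}"

text \<open>\<open>staircase m\<close> is the set of all sequences
  \<open>0\<^bsup>\<sigma>(0)\<^esup> 1\<^bsup>\<sigma>(1)\<^esup> \<dots> (m-1)\<^bsup>\<sigma>(m-1)\<^esup> m m m \<dots>\<close> with \<open>\<sigma> \<in> \<nat>\<^sup>m\<close>.\<close>

definition staircase :: "nat \<Rightarrow> baire set" where
  "staircase m = {conc (concat (map (\<lambda>k. replicate (\<sigma> ! k) k) [0..<m])) (\<lambda>_. m) | \<sigma>.
    length \<sigma> = m}"

definition g_problem :: "nat \<Rightarrow> problem" where
  "g_problem n p = (if inf_often p n \<noteq> {} then staircase (Min (inf_often p n)) else staircase n)"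

end

theory Submission
  imports Defs
begin

text \<open>
  By induction on \<open>n\<close>, starting at \<open>n = 0\<close>: the only value of \<open>g_problem 0\<close> is the zero sequence,
  so \<open>g_problem 0\<close> is equivalent to the identity. Since the tot-jump is monotone
  (\<open>tot_jump_mono\<close>), the induction step is the equivalence of \<open>tot_jump (g_problem n)\<close> with
  \<open>g_problem (Suc n)\<close>. Two descriptions keep the combinatorics small. A sequence is in
  \<open>staircase m\<close> iff it is nondecreasing and eventually equal to \<open>m\<close> (\<open>staircase_iff\<close>), and
  \<open>g_problem n p\<close> is \<open>staircase (level n p)\<close>, where \<open>level n p\<close> is the least number that is \<open>n\<close> or
  occurs infinitely often in \<open>p\<close>.

  \<^emph>\<open>Reducing \<open>g_problem (Suc n)\<close> to the jump\<close> (\<open>g_problem_le_tot_jump\<close>). On an instance \<open>p\<close>, the jump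
  is asked for a solution \<open>q\<close> of \<open>g_problem n p\<close> in which every entry \<open>q x\<close> carries a certificate:
  a position from \<open>x\<close> on at which \<open>p\<close> takes the value \<open>q x\<close>, or a position at which \<open>q\<close> has moved beyond
  \<open>q x\<close>. If some \<open>k \<le> n\<close> occurs infinitely often in \<open>p\<close>, then every solution has all certificates,
  and the solutions for \<open>n\<close> and for \<open>Suc n\<close> coincide. Otherwise the jump may return an arbitrary
  sequence, but it cannot be a correctly certified one; once an error is found, the output changes
  to \<open>Suc n\<close> forever, as it must.

  \<^emph>\<open>Reducing the jump to \<open>g_problem (Suc n)\<close>\<close> (\<open>tot_jump_le_g_problem\<close>). From an instance
  \<open>(e, i, p)\<close> one computes a sequence in which \<open>m \<le> n\<close> occurs infinitely often iff \<open>\<Phi>\<^sub>e(p)\<close> takes the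
  value \<open>m\<close> infinitely often (demanded for \<open>m < n\<close> only) and \<open>\<Phi>\<^sub>i(p, q)\<close> is total for each of the
  countably many \<open>q\<close> in \<open>staircase m\<close>. This is possible because the condition is \<open>\<Pi>\<^sub>2\<close>. If the
  jump's side condition holds, the level of the new sequence is that of \<open>\<Phi>\<^sub>e(p)\<close>, so a solution \<open>q\<close>
  for it is one for \<open>\<Phi>\<^sub>e(p)\<close>, and \<open>\<Phi>\<^sub>i(p, q)\<close> is an answer. If it fails, any total output will do:
  either \<open>q\<close> settles at some \<open>m \<le> n\<close>, and then \<open>\<Phi>\<^sub>i(p, q)\<close> is total by construction, or \<open>q\<close> reaches
  \<open>Suc n\<close>, which is eventually seen and replaces all computations that have not halted.

  Both the monotonicity of the jump and the second reduction simulate programs given by their codes.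
  For this, halting is expressed by a decidable relation: \<open>computation p c x w\<close> says that \<open>w\<close> codes
  a finite derivation showing that the program coded by \<open>c\<close> halts on \<open>x\<close>, with output the first
  component of \<open>w\<close>.
\<close>

section \<open>Functions computable uniformly in the oracle\<close>

abbreviation pr1 :: "nat \<Rightarrow> nat" where "pr1 z \<equiv> fst (prod_decode z)"
abbreviation pr2 :: "nat \<Rightarrow> nat" where "pr2 z \<equiv> snd (prod_decode z)"
abbreviation code :: "nat \<Rightarrow> nat \<Rightarrow> nat" where "code x y \<equiv> prod_encode (x, y)"

text \<open>A single program has to work for all oracles, and it is total for each of them. The rules
  \<open>rec_intros\<close> below follow the syntax of a term, so that computability of a concrete function is
  proved by repeated introduction. Bound variables of quantifiers, recursions and searches are
  passed to the program as the second component of a coded pair.\<close>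

definition rec_fun :: "(baire \<Rightarrow> nat \<Rightarrow> nat) \<Rightarrow> bool" where
  "rec_fun f \<longleftrightarrow> (\<exists>c. \<forall>p x. eval p c x (f p x))"

definition rec_rel :: "(baire \<Rightarrow> nat \<Rightarrow> bool) \<Rightarrow> bool" where
  "rec_rel P \<longleftrightarrow> rec_fun (\<lambda>p x. if P p x then 1 else 0)"

named_theorems rec_intros

lemma rec_fun_eq: "rec_fun f \<Longrightarrow> (\<And>p x. f p x = g p x) \<Longrightarrow> rec_fun g"
  unfolding rec_fun_def by simp

lemma rec_rel_eq: "rec_rel P \<Longrightarrow> (\<And>p x. P p x \<longleftrightarrow> Q p x) \<Longrightarrow> rec_rel Q"
  unfolding rec_rel_def by simp

lemma eval_id: "eval p (Pair Fst Snd) x x"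
  using eval.Pair[OF eval.Fst eval.Snd, of p x] by simp

lemma rec_id [rec_intros]: "rec_fun (\<lambda>p x. x)"
  unfolding rec_fun_def using eval_id by blast

lemma rec_Suc [rec_intros]: "rec_fun f \<Longrightarrow> rec_fun (\<lambda>p x. Suc (f p x))"
  unfolding rec_fun_def by (meson eval.Comp eval.Succ)

lemma rec_const [rec_intros]: "rec_fun (\<lambda>p x. k)"
proof (induction k)
  case 0
  show ?case unfolding rec_fun_def by (meson eval.Zero)
next
  case (Suc k)
  then show ?case by (rule rec_Suc)
qed

lemma rec_pr1 [rec_intros]: "rec_fun f \<Longrightarrow> rec_fun (\<lambda>p x. pr1 (f p x))"
  unfolding rec_fun_def by (meson eval.Comp eval.Fst)

lemma rec_pr2 [rec_intros]: "rec_fun f \<Longrightarrow> rec_fun (\<lambda>p x. pr2 (f p x))"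
  unfolding rec_fun_def by (meson eval.Comp eval.Snd)

lemma rec_oracle [rec_intros]: "rec_fun f \<Longrightarrow> rec_fun (\<lambda>p x. p (f p x))"
  unfolding rec_fun_def by (meson eval.Comp eval.Oracle)

lemma rec_code [rec_intros]:
  "rec_fun f \<Longrightarrow> rec_fun g \<Longrightarrow> rec_fun (\<lambda>p x. code (f p x) (g p x))"
  unfolding rec_fun_def by (meson eval.Pair)

lemma rec_comp: "rec_fun f \<Longrightarrow> rec_fun g \<Longrightarrow> rec_fun (\<lambda>p x. f p (g p x))"
  unfolding rec_fun_def by (meson eval.Comp)

text \<open>Serves to derive rules for a function of two arguments from the computability of its coded form,
  as it is given by a premise about bound variables.\<close>

lemma rec_comp2:
  assumes "rec_fun (\<lambda>p z. h p (pr1 z) (pr2 z))" "rec_fun f" "rec_fun g"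
  shows "rec_fun (\<lambda>p x. h p (f p x) (g p x))"
  using rec_comp[OF assms(1) rec_code[OF assms(2,3)]] by simp

lemma rec_rec_nat [rec_intros]:
  assumes f: "rec_fun f" and g: "rec_fun (\<lambda>p z. g p (pr1 z) (pr1 (pr2 z)) (pr2 (pr2 z)))"
    and h: "rec_fun h"
  shows "rec_fun (\<lambda>p x. rec_nat (f p x) (\<lambda>k y. g p x k y) (h p x))"
proof -
  obtain a where a: "eval p a x (f p x)" for p x using f unfolding rec_fun_def by blast
  obtain b where b: "eval p b z (g p (pr1 z) (pr1 (pr2 z)) (pr2 (pr2 z)))" for p z
    using g unfolding rec_fun_def by blast
  obtain c where c: "eval p c x (h p x)" for p x using h unfolding rec_fun_def by blast
  have prec: "eval p (Prec a b) (code x k) (rec_nat (f p x) (\<lambda>k y. g p x k y) k)" for p x k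
  proof (induction k)
    case 0
    show ?case by (simp add: eval.Prec_0 a)
  next
    case (Suc k)
    show ?case
      using eval.Prec_Suc[OF Suc b] by simp
  qed
  show ?thesis
    unfolding rec_fun_def
  proof (intro exI allI)
    fix p x
    show "eval p (Comp (Prec a b) (Pair (Pair Fst Snd) c)) x (rec_nat (f p x) (g p x) (h p x))"
      by (rule eval.Comp[OF eval.Pair[OF eval_id c] prec])
  qed
qed

lemma rec_case_nat [rec_intros]:
  assumes "rec_fun f" "rec_fun (\<lambda>p z. g p (pr1 z) (pr2 z))" "rec_fun h"
  shows "rec_fun (\<lambda>p x. case h p x of 0 \<Rightarrow> f p x | Suc k \<Rightarrow> g p x k)"
proof -
  have "rec_fun (\<lambda>p z. g p (pr1 z) (pr1 (pr2 z)))"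
    by (rule rec_comp2[OF assms(2)]) (intro rec_intros)+
  then have "rec_fun (\<lambda>p x. rec_nat (f p x) (\<lambda>k _. g p x k) (h p x))"
    by (intro rec_rec_nat assms)
  moreover have "rec_nat a (\<lambda>k _. b k) n = (case n of 0 \<Rightarrow> a | Suc k \<Rightarrow> b k)" for a b and n :: nat
    by (cases n) auto
  ultimately show ?thesis by (rule rec_fun_eq)
qed

lemma rec_add [rec_intros]:
  assumes "rec_fun f" "rec_fun g" shows "rec_fun (\<lambda>p x. f p x + g p x)"
proof -
  have "rec_fun (\<lambda>p x. rec_nat (f p x) (\<lambda>k y. Suc y) (g p x))"
    by (intro rec_intros assms)
  moreover have "rec_nat a (\<lambda>k y. Suc y) b = a + b" for a b :: nat
    by (induction b) auto
  ultimately show ?thesis by (rule rec_fun_eq)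
qed

lemma rec_diff [rec_intros]:
  assumes "rec_fun f" "rec_fun g" shows "rec_fun (\<lambda>p x. f p x - g p x)"
proof -
  have "rec_fun (\<lambda>p x. rec_nat (f p x) (\<lambda>_ y. case y of 0 \<Rightarrow> 0 | Suc z \<Rightarrow> z) (g p x))"
    by (intro rec_intros assms)
  moreover have "rec_nat a (\<lambda>_ y. case y of 0 \<Rightarrow> 0 | Suc z \<Rightarrow> z) b = a - b" for a b :: nat
    by (induction b) (auto split: nat.split)
  ultimately show ?thesis by (rule rec_fun_eq)
qed

lemma rec_mult4 [rec_intros]:
  assumes "rec_fun f" shows "rec_fun (\<lambda>p x. 4 * f p x)"
proof (rule rec_fun_eq)
  show "rec_fun (\<lambda>p x. (f p x + f p x) + (f p x + f p x))"
    by (intro rec_intros assms)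
qed simp

lemma rec_if [rec_intros]:
  assumes "rec_rel P" "rec_fun f" "rec_fun g"
  shows "rec_fun (\<lambda>p x. if P p x then f p x else g p x)"
proof -
  have "rec_fun (\<lambda>p x. case if P p x then 1 else 0 of 0 \<Rightarrow> g p x | Suc k \<Rightarrow> f p x)"
    by (intro rec_intros assms rec_comp[OF assms(2)] assms(1)[unfolded rec_rel_def])
  moreover have "(case if b then 1 else 0 of 0 \<Rightarrow> v | Suc k \<Rightarrow> u) = (if b then u else v)"
    for b and u v :: nat
    by simp
  ultimately show ?thesis by (rule rec_fun_eq)
qed

lemma rec_not [rec_intros]:
  assumes "rec_rel P" shows "rec_rel (\<lambda>p x. \<not> P p x)"
  unfolding rec_rel_def
proof (rule rec_fun_eq)
  show "rec_fun (\<lambda>p x. if P p x then 0 else 1)"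
    by (intro rec_intros assms)
qed simp

lemma rec_conj [rec_intros]:
  assumes "rec_rel P" "rec_rel Q" shows "rec_rel (\<lambda>p x. P p x \<and> Q p x)"
proof -
  have "rec_fun (\<lambda>p x. if P p x then if Q p x then 1 else 0 else 0)"
    by (intro rec_intros assms)
  moreover have "(if a then if b then 1 else 0 else 0) = (if a \<and> b then 1 else (0::nat))" for a b
    by simp
  ultimately show ?thesis unfolding rec_rel_def by (rule rec_fun_eq)
qed

lemma rec_disj [rec_intros]:
  assumes "rec_rel P" "rec_rel Q" shows "rec_rel (\<lambda>p x. P p x \<or> Q p x)"
proof -
  have "rec_rel (\<lambda>p x. \<not> (\<not> P p x \<and> \<not> Q p x))"
    by (intro rec_intros assms)
  then show ?thesis by (rule rec_rel_eq) auto
qed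

lemma rec_imp [rec_intros]:
  assumes "rec_rel P" "rec_rel Q" shows "rec_rel (\<lambda>p x. P p x \<longrightarrow> Q p x)"
proof -
  have "rec_rel (\<lambda>p x. \<not> P p x \<or> Q p x)"
    by (intro rec_intros assms)
  then show ?thesis by (rule rec_rel_eq) auto
qed

lemma rec_less [rec_intros]:
  assumes "rec_fun f" "rec_fun g" shows "rec_rel (\<lambda>p x. f p x < g p x)"
proof -
  have "rec_fun (\<lambda>p x. case g p x - f p x of 0 \<Rightarrow> 0 | Suc _ \<Rightarrow> 1)"
    by (intro rec_intros assms)
  moreover have "(case b - a of 0 \<Rightarrow> 0 | Suc _ \<Rightarrow> 1) = (if a < b then 1 else (0::nat))" for a b :: nat
    by (auto split: nat.split)
  ultimately show ?thesis unfolding rec_rel_def by (rule rec_fun_eq)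
qed

lemma rec_le [rec_intros]:
  assumes "rec_fun f" "rec_fun g" shows "rec_rel (\<lambda>p x. f p x \<le> g p x)"
  by (rule rec_rel_eq[OF rec_not[OF rec_less[OF assms(2,1)]]]) auto

lemma rec_eq [rec_intros]:
  fixes f g :: "baire \<Rightarrow> nat \<Rightarrow> nat"
  assumes "rec_fun f" "rec_fun g" shows "rec_rel (\<lambda>p x. f p x = g p x)"
  by (rule rec_rel_eq[OF rec_conj[OF rec_le[OF assms] rec_le[OF assms(2,1)]]]) auto

lemma rec_bex [rec_intros]:
  assumes P: "rec_rel (\<lambda>p z. P p (pr1 z) (pr2 z))" and f: "rec_fun f"
  shows "rec_rel (\<lambda>p x. \<exists>i<f p x. P p x i)"
proof -
  have "rec_fun (\<lambda>p z. if P p (pr1 z) (pr2 z) then 1 else 0)"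
    using P unfolding rec_rel_def .
  from rec_comp2[OF this, of "\<lambda>p z. pr1 z" "\<lambda>p z. pr1 (pr2 z)"]
  have "rec_rel (\<lambda>p z. P p (pr1 z) (pr1 (pr2 z)))"
    unfolding rec_rel_def by (simp add: rec_intros)
  then have "rec_fun (\<lambda>p x. rec_nat 0 (\<lambda>k y. if P p x k then 1 else y) (f p x))"
    by (intro rec_intros f)
  moreover have "rec_nat 0 (\<lambda>k y. if Q k then 1 else y) n = (if \<exists>i<n. Q i then 1 else 0)"
    for Q and n :: nat
    by (induction n) (auto simp: less_Suc_eq)
  ultimately show ?thesis unfolding rec_rel_def by (rule rec_fun_eq)
qed

lemma rec_ball [rec_intros]:
  assumes P: "rec_rel (\<lambda>p z. P p (pr1 z) (pr2 z))" and f: "rec_fun f"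
  shows "rec_rel (\<lambda>p x. \<forall>i<f p x. P p x i)"
proof -
  have "rec_rel (\<lambda>p x. \<not> (\<exists>i<f p x. \<not> P p x i))"
    by (intro rec_intros assms)
  then show ?thesis by (rule rec_rel_eq) auto
qed

lemma rec_even [rec_intros]:
  assumes "rec_fun f" shows "rec_rel (\<lambda>p x. even (f p x))"
proof -
  have "rec_rel (\<lambda>p x. \<exists>k<Suc (f p x). f p x = k + k)"
    by (intro rec_intros rec_comp[OF assms] assms)
  moreover have "(\<exists>k<Suc n. n = k + k) \<longleftrightarrow> even n" for n
    by presburger
  ultimately show ?thesis by (rule rec_rel_eq)
qed

text \<open>Together with the parity test, halving makes \<^const>\<open>pair\<close> computable.\<close>

lemma rec_half [rec_intros]:
  assumes "rec_fun f" shows "rec_fun (\<lambda>p x. f p x div 2)"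
proof -
  have "rec_fun (\<lambda>p x. rec_nat 0 (\<lambda>k h. if even k then h else Suc h) (f p x))"
    by (intro rec_intros assms)
  moreover have "rec_nat 0 (\<lambda>k h. if even k then h else Suc h) n = n div 2" for n
    by (induction n) (auto elim!: evenE oddE)
  ultimately show ?thesis by (rule rec_fun_eq)
qed

lemma rec_pair [rec_intros]:
  assumes "rec_fun (\<lambda>p z. q p (pr1 z) (pr2 z))" "rec_fun (\<lambda>p z. r p (pr1 z) (pr2 z))" "rec_fun f"
  shows "rec_fun (\<lambda>p x. pair (q p x) (r p x) (f p x))"
  unfolding pair_def
  by (intro rec_intros rec_comp2[OF assms(1)] rec_comp2[OF assms(2)] assms(3))

lemma pair_double [simp]: "pair p q (n + n) = p n" "pair p q (Suc (n + n)) = q n"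
  by (simp_all add: pair_def mult_2[symmetric])

text \<open>The only source of partial programs: minimization over a decidable relation, followed by a total
  computation with the witness found.\<close>

lemma search:
  assumes "rec_rel (\<lambda>p z. P p (pr1 z) (pr2 z))" and "rec_fun (\<lambda>p z. f p (pr1 z) (pr2 z))"
  obtains c where "\<And>p x w. P p x w \<Longrightarrow> eval p c x (f p x (LEAST w. P p x w))"
proof -
  obtain b where b: "eval p b z (f p (pr1 z) (pr2 z))" for p z
    using assms(2) unfolding rec_fun_def by blast
  obtain a where a: "eval p a z (if P p (pr1 z) (pr2 z) then 0 else Suc 0)" for p z
    using rec_if[OF assms(1) rec_const rec_const] unfolding rec_fun_def by blast
  have "eval p (Comp b (Pair (Pair Fst Snd) (Mu a))) x (f p x (LEAST w. P p x w))"
    if w: "P p x w" for p x w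
  proof -
    have "eval p (Mu a) x (LEAST w. P p x w)"
    proof (rule eval.Mu)
      show "eval p a (code x (LEAST w. P p x w)) 0"
        using a[of p "code x (LEAST w. P p x w)"] LeastI[of "P p x", OF w] by simp
      show "\<forall>j<LEAST w. P p x w. \<exists>y. eval p a (code x j) (Suc y)"
        using a[of p "code x _"] not_less_Least[of _ "P p x"] by (smt (verit) fst_conv prod_encode_inverse snd_conv)
    qed
    from eval.Comp[OF eval.Pair[OF eval_id this] b] show ?thesis by simp
  qed
  then show ?thesis using that by blast
qed

text \<open>Composition of functionals: calls of the oracle are replaced by calls of a program for it. If that
  program is total at the given oracle, the two oracles cannot be distinguished.\<close>

primrec subst :: "prog \<Rightarrow> prog \<Rightarrow> prog" where
  "subst d Zero = Zero"
| "subst d Succ = Succ"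
| "subst d Fst = Fst"
| "subst d Snd = Snd"
| "subst d Oracle = d"
| "subst d (Pair a b) = Pair (subst d a) (subst d b)"
| "subst d (Comp a b) = Comp (subst d a) (subst d b)"
| "subst d (Prec a b) = Prec (subst d a) (subst d b)"
| "subst d (Mu a) = Mu (subst d a)"

lemma functional_subst:
  assumes "functional d p = Some q" "functional c q = Some r"
  shows "functional (subst d c) p = Some r"
proof -
  have d: "eval p d x (q x)" for x using assms(1) by (simp add: functional_eq_Some_iff)
  have "eval q c x y \<Longrightarrow> eval p (subst d c) x y" for c x y
    by (induction rule: eval.induct) (auto intro: eval.intros d)
  then show ?thesis using assms(2) by (simp add: functional_eq_Some_iff)
qed

lemma rec_functional:
  assumes "rec_fun f" obtains c where "\<And>p. functional c p = Some (f p)"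
  using assms unfolding rec_fun_def functional_eq_Some_iff by auto

text \<open>Both programs are run on every input, which is harmless because the lemma only concerns oracles
  at which both are total; the right output is selected afterwards.\<close>

lemma functional_pair:
  "\<exists>c. \<forall>p q r. functional a p = Some q \<longrightarrow> functional b p = Some r \<longrightarrow>
    functional c p = Some (pair q r)"
proof -
  obtain h where h: "eval p h x (x div 2)" for p x
    using rec_half[OF rec_id] unfolding rec_fun_def by blast
  have "rec_fun (\<lambda>p z. if even (pr1 z) then pr1 (pr2 z) else pr2 (pr2 z))"
    by (intro rec_intros)
  then obtain i where i: "eval p i z (if even (pr1 z) then pr1 (pr2 z) else pr2 (pr2 z))" for p z
    unfolding rec_fun_def by blast
  have "functional (Comp i (Pair (Pair Fst Snd) (Pair (Comp a h) (Comp b h)))) p = Some (pair q r)"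
    if a: "functional a p = Some q" and b: "functional b p = Some r" for p q r
    unfolding functional_eq_Some_iff
  proof
    fix x
    have "eval p (Pair (Pair Fst Snd) (Pair (Comp a h) (Comp b h))) x
        (code x (code (q (x div 2)) (r (x div 2))))"
      using a b unfolding functional_eq_Some_iff by (intro eval.Pair eval_id eval.Comp[OF h]) auto
    from eval.Comp[OF this i]
    show "eval p (Comp i (Pair (Pair Fst Snd) (Pair (Comp a h) (Comp b h)))) x (pair q r x)"
      by (cases "even x") (simp_all add: pair_def)
  qed
  then show ?thesis by blast
qed

section \<open>A decidable halting relation\<close>

definition prog_decode :: "nat \<Rightarrow> prog" where "prog_decode = inv prog_encode"

lemma prog_decode_encode [simp]: "prog_decode (prog_encode c) = c"
  unfolding prog_decode_def by (rule inv_f_f[OF bij_is_inj[OF bij_prog_encode]])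

lemma prog_encode_decode [simp]: "prog_encode (prog_decode n) = n"
  unfolding prog_decode_def by (rule surj_f_inv_f[OF bij_is_surj[OF bij_prog_encode]])

lemma prog_decode_eq: "prog_encode c = n \<Longrightarrow> prog_decode n = c"
  by auto

lemma prog_decode_simps [simp]:
  "prog_decode 0 = Zero" "prog_decode 1 = Succ" "prog_decode (Suc 0) = Succ"
  "prog_decode 2 = Fst" "prog_decode 3 = Snd" "prog_decode 4 = Oracle"
  "prog_decode (4 * m + 5) = Pair (prog_decode (pr1 m)) (prog_decode (pr2 m))"
  "prog_decode (4 * m + 6) = Comp (prog_decode (pr1 m)) (prog_decode (pr2 m))"
  "prog_decode (4 * m + 7) = Prec (prog_decode (pr1 m)) (prog_decode (pr2 m))"
  "prog_decode (4 * m + 8) = Mu (prog_decode m)"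
  by (rule prog_decode_eq, simp)+

definition triple :: "nat \<Rightarrow> nat \<Rightarrow> nat \<Rightarrow> nat" where
  "triple c x y = code c (code x y)"

text \<open>The rules of \<^const>\<open>eval\<close>, read on codes: \<open>derives p S c x y\<close> says that one rule, with premises
  among the judgements coded in \<open>S\<close>, yields that the program coded by \<open>c\<close> maps \<open>x\<close> to \<open>y\<close>. Every
  quantifier ranges over \<open>S\<close> or is bounded by a number, so that the relation is decidable for
  finite \<open>S\<close>.\<close>

definition derives :: "baire \<Rightarrow> nat set \<Rightarrow> nat \<Rightarrow> nat \<Rightarrow> nat \<Rightarrow> bool" where
  "derives p S c x y \<longleftrightarrow>
     c = 0 \<and> y = 0 \<or> c = 1 \<and> y = Suc x \<or> c = 2 \<and> y = pr1 x \<or> c = 3 \<and> y = pr2 x \<or>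
     c = 4 \<and> y = p x \<or>
     (\<exists>m<c. c = 4 * m + 5 \<and> triple (pr1 m) x (pr1 y) \<in> S \<and> triple (pr2 m) x (pr2 y) \<in> S) \<or>
     (\<exists>m<c. c = 4 * m + 6 \<and>
        (\<exists>e\<in>S. pr1 e = pr2 m \<and> pr1 (pr2 e) = x \<and> triple (pr1 m) (pr2 (pr2 e)) y \<in> S)) \<or>
     (\<exists>m<c. c = 4 * m + 7 \<and>
        (pr2 x = 0 \<and> triple (pr1 m) (pr1 x) y \<in> S \<or>
         (\<exists>k<pr2 x. pr2 x = Suc k \<and>
            (\<exists>e\<in>S. pr1 e = c \<and> pr1 (pr2 e) = code (pr1 x) k \<and>
               triple (pr2 m) (code (pr1 x) (code k (pr2 (pr2 e)))) y \<in> S)))) \<or>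
     (\<exists>m<c. c = 4 * m + 8 \<and> triple m (code x y) 0 \<in> S \<and>
        (\<forall>k<y. \<exists>e\<in>S. pr1 e = m \<and> pr1 (pr2 e) = code x k \<and> 0 < pr2 (pr2 e)))"

definition sound_for :: "baire \<Rightarrow> nat \<Rightarrow> bool" where
  "sound_for p e \<longleftrightarrow> eval p (prog_decode (pr1 e)) (pr1 (pr2 e)) (pr2 (pr2 e))"

lemma sound_for_triple [simp]: "sound_for p (triple c x y) \<longleftrightarrow> eval p (prog_decode c) x y"
  by (simp add: sound_for_def triple_def)

lemma derives_sound:
  assumes S: "\<And>e. e \<in> S \<Longrightarrow> sound_for p e" and d: "derives p S c x y"
  shows "eval p (prog_decode c) x y"
  using d unfolding derives_def
proof (elim disjE conjE exE bexE)
  fix m assume m: "c = 4 * m + 5" "triple (pr1 m) x (pr1 y) \<in> S" "triple (pr2 m) x (pr2 y) \<in> S"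
  have "eval p (Pair (prog_decode (pr1 m)) (prog_decode (pr2 m))) x (code (pr1 y) (pr2 y))"
    using S[OF m(2)] S[OF m(3)] by (intro eval.Pair) auto
  then show ?thesis using m(1) by simp
next
  fix m e assume m: "c = 4 * m + 6" "e \<in> S" "pr1 e = pr2 m" "pr1 (pr2 e) = x"
    "triple (pr1 m) (pr2 (pr2 e)) y \<in> S"
  have "eval p (prog_decode (pr2 m)) x (pr2 (pr2 e))" using S[OF m(2)] m by (simp add: sound_for_def)
  from eval.Comp[OF this] S[OF m(5)] show ?thesis using m(1) by simp
next
  fix m assume m: "c = 4 * m + 7" "pr2 x = 0" "triple (pr1 m) (pr1 x) y \<in> S"
  have "eval p (Prec (prog_decode (pr1 m)) (prog_decode (pr2 m))) (code (pr1 x) 0) y"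
    using S[OF m(3)] by (intro eval.Prec_0) simp
  then have "eval p (prog_decode c) (code (pr1 x) (pr2 x)) y" using m(1,2) by simp
  then show ?thesis by simp
next
  fix m k e assume m: "c = 4 * m + 7" "pr2 x = Suc k" "e \<in> S" "pr1 e = c"
    "pr1 (pr2 e) = code (pr1 x) k" "triple (pr2 m) (code (pr1 x) (code k (pr2 (pr2 e)))) y \<in> S"
  have "eval p (Prec (prog_decode (pr1 m)) (prog_decode (pr2 m))) (code (pr1 x) k) (pr2 (pr2 e))"
    using S[OF m(3)] m by (simp add: sound_for_def)
  from eval.Prec_Suc[OF this] S[OF m(6)]
  have "eval p (prog_decode c) (code (pr1 x) (pr2 x)) y" using m(1,2) by simp
  then show ?thesis by simp
next
  fix m assume m: "c = 4 * m + 8" "triple m (code x y) 0 \<in> S"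
    "\<forall>k<y. \<exists>e\<in>S. pr1 e = m \<and> pr1 (pr2 e) = code x k \<and> 0 < pr2 (pr2 e)"
  have "eval p (Mu (prog_decode m)) x y"
  proof (rule eval.Mu)
    show "eval p (prog_decode m) (code x y) 0" using S[OF m(2)] by simp
    show "\<forall>k<y. \<exists>z. eval p (prog_decode m) (code x k) (Suc z)"
    proof (intro allI impI)
      fix k assume "k < y"
      then obtain e where e: "e \<in> S" "pr1 e = m" "pr1 (pr2 e) = code x k" "0 < pr2 (pr2 e)"
        using m(3) by blast
      then obtain z where "pr2 (pr2 e) = Suc z" by (metis gr0_implies_Suc)
      then show "\<exists>z. eval p (prog_decode m) (code x k) (Suc z)"
        using S[OF e(1)] e by (auto simp: sound_for_def)
    qed
  qed
  then show ?thesis using m(1) by simp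
qed (auto intro: eval.intros simp: numeral_3_eq_3[symmetric])

text \<open>The sequence \<open>t\<close> plays the role of a list of length \<open>l\<close> of coded judgements, each derived from
  earlier ones.\<close>

definition derivation :: "baire \<Rightarrow> baire \<Rightarrow> nat \<Rightarrow> bool" where
  "derivation p t l \<longleftrightarrow>
    (\<forall>j<l. derives p (t ` {..<j}) (pr1 (t j)) (pr1 (pr2 (t j))) (pr2 (pr2 (t j))))"

lemma derivation_sound:
  assumes "derivation p t l" "j < l" shows "sound_for p (t j)"
  using assms(2)
proof (induction j rule: less_induct)
  case (less j)
  have "derives p (t ` {..<j}) (pr1 (t j)) (pr1 (pr2 (t j))) (pr2 (pr2 (t j)))"
    using assms(1) less.prems by (simp add: derivation_def)
  then show ?case
    unfolding sound_for_def by (rule derives_sound[rotated]) (use less in auto)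
qed

definition derivable :: "baire \<Rightarrow> nat set \<Rightarrow> bool" where
  "derivable p S \<longleftrightarrow> (\<exists>t l. derivation p t l \<and> S = t ` {..<l})"

lemma derivation_extend:
  assumes "derivation p t l" "derives p (t ` {..<l}) c x y"
  shows "derivation p (t(l := triple c x y)) (Suc l)"
  unfolding derivation_def
proof (intro allI impI)
  let ?t = "t(l := triple c x y)"
  fix j assume "j < Suc l"
  then have image: "?t ` {..<j} = t ` {..<j}" by (intro image_cong) auto
  show "derives p (?t ` {..<j}) (pr1 (?t j)) (pr1 (pr2 (?t j))) (pr2 (pr2 (?t j)))"
  proof (cases "j = l")
    case True
    then show ?thesis unfolding image using assms(2) by (simp add: triple_def)
  next
    case False
    then have "j < l" using \<open>j < Suc l\<close> by simp
    then show ?thesis unfolding image using assms(1) False by (simp add: derivation_def)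
  qed
qed

lemma derivable_insert:
  assumes "derivable p S" "derives p S c x y" shows "derivable p (insert (triple c x y) S)"
proof -
  obtain t l where t: "derivation p t l" "S = t ` {..<l}" using assms(1) by (auto simp: derivable_def)
  have "insert (triple c x y) S = (t(l := triple c x y)) ` {..<Suc l}"
    using t(2) by (auto simp: lessThan_Suc)
  then show ?thesis using derivation_extend[of p t l c x y] t assms(2) unfolding derivable_def by metis
qed

lemma derivable_step:
  assumes "derivable p S'" "derives p S' c x y" "S \<subseteq> S'"
  shows "\<exists>S''. S \<subseteq> S'' \<and> derivable p S'' \<and> triple c x y \<in> S''"
  using derivable_insert[OF assms(1,2)] assms(3)
  by (intro exI[of _ "insert (triple c x y) S'"]) auto

lemma derives_Pair:
  assumes "triple (prog_encode a) x y \<in> S" "triple (prog_encode b) x z \<in> S"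
  shows "derives p S (prog_encode (Pair a b)) x (code y z)"
proof -
  let ?m = "code (prog_encode a) (prog_encode b)"
  have "?m < prog_encode (Pair a b)" "prog_encode (Pair a b) = 4 * ?m + 5"
    "triple (pr1 ?m) x (pr1 (code y z)) \<in> S" "triple (pr2 ?m) x (pr2 (code y z)) \<in> S"
    using assms by simp_all
  then show ?thesis unfolding derives_def by blast
qed

lemma derives_Comp:
  assumes "triple (prog_encode b) x y \<in> S" "triple (prog_encode a) y z \<in> S"
  shows "derives p S (prog_encode (Comp a b)) x z"
proof -
  let ?m = "code (prog_encode a) (prog_encode b)" and ?e = "triple (prog_encode b) x y"
  have "?m < prog_encode (Comp a b)" "prog_encode (Comp a b) = 4 * ?m + 6"
    "pr1 ?e = pr2 ?m" "pr1 (pr2 ?e) = x" "triple (pr1 ?m) (pr2 (pr2 ?e)) z \<in> S"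
    using assms by (simp_all add: triple_def)
  then show ?thesis unfolding derives_def using assms(1) by blast
qed

lemma derives_Prec_0:
  assumes "triple (prog_encode a) x y \<in> S"
  shows "derives p S (prog_encode (Prec a b)) (code x 0) y"
proof -
  let ?m = "code (prog_encode a) (prog_encode b)"
  have "?m < prog_encode (Prec a b)" "prog_encode (Prec a b) = 4 * ?m + 7"
    "pr2 (code x 0) = 0" "triple (pr1 ?m) (pr1 (code x 0)) y \<in> S"
    using assms by simp_all
  then show ?thesis unfolding derives_def by blast
qed

lemma derives_Prec_Suc:
  assumes "triple (prog_encode (Prec a b)) (code x k) y \<in> S"
    "triple (prog_encode b) (code x (code k y)) z \<in> S"
  shows "derives p S (prog_encode (Prec a b)) (code x (Suc k)) z"
proof -
  let ?m = "code (prog_encode a) (prog_encode b)" and ?x = "code x (Suc k)"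
    and ?e = "triple (prog_encode (Prec a b)) (code x k) y"
  have "?m < prog_encode (Prec a b)" "prog_encode (Prec a b) = 4 * ?m + 7"
    "k < pr2 ?x" "pr2 ?x = Suc k" "pr1 ?e = prog_encode (Prec a b)"
    "pr1 (pr2 ?e) = code (pr1 ?x) k"
    "triple (pr2 ?m) (code (pr1 ?x) (code k (pr2 (pr2 ?e)))) z \<in> S"
    using assms by (simp_all add: triple_def)
  then show ?thesis unfolding derives_def using assms(1) by blast
qed

lemma derives_Mu:
  assumes "triple (prog_encode a) (code x k) 0 \<in> S"
    "\<And>j. j < k \<Longrightarrow> \<exists>y. triple (prog_encode a) (code x j) (Suc y) \<in> S"
  shows "derives p S (prog_encode (Mu a)) x k"
proof -
  let ?m = "prog_encode a"
  have "?m < prog_encode (Mu a)" "prog_encode (Mu a) = 4 * ?m + 8"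
    by simp_all
  moreover have "\<forall>j<k. \<exists>e\<in>S. pr1 e = ?m \<and> pr1 (pr2 e) = code x j \<and> 0 < pr2 (pr2 e)"
  proof (intro allI impI)
    fix j assume "j < k"
    then obtain y where y: "triple ?m (code x j) (Suc y) \<in> S" using assms(2) by blast
    show "\<exists>e\<in>S. pr1 e = ?m \<and> pr1 (pr2 e) = code x j \<and> 0 < pr2 (pr2 e)"
      by (rule bexI[OF _ y]) (simp add: triple_def)
  qed
  ultimately show ?thesis unfolding derives_def using assms(1) by blast
qed

text \<open>Extending an arbitrary given set of judgements, instead of starting from nothing, makes it easy to
  treat rules with several premises: the derivations are produced one after the other, each on top
  of the preceding ones.\<close>

lemma eval_derivable:
  assumes "eval p c x y" "derivable p S"
  shows "\<exists>S'. S \<subseteq> S' \<and> derivable p S' \<and> triple (prog_encode c) x y \<in> S'"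
  using assms
proof (induction arbitrary: S rule: eval.induct)
  case (Pair a x y b z)
  obtain S1 where S1: "S \<subseteq> S1" "derivable p S1" "triple (prog_encode a) x y \<in> S1"
    using Pair.IH(1) Pair.prems by blast
  obtain S2 where S2: "S1 \<subseteq> S2" "derivable p S2" "triple (prog_encode b) x z \<in> S2"
    using Pair.IH(2) S1(2) by blast
  show ?case
    by (rule derivable_step[OF S2(2) derives_Pair[OF _ S2(3)]]) (use S1 S2 in auto)
next
  case (Comp b x y a z)
  obtain S1 where S1: "S \<subseteq> S1" "derivable p S1" "triple (prog_encode b) x y \<in> S1"
    using Comp.IH(1) Comp.prems by blast
  obtain S2 where S2: "S1 \<subseteq> S2" "derivable p S2" "triple (prog_encode a) y z \<in> S2"
    using Comp.IH(2) S1(2) by blast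
  show ?case
    by (rule derivable_step[OF S2(2) derives_Comp[OF _ S2(3)]]) (use S1 S2 in auto)
next
  case (Prec_0 a x y b)
  obtain S1 where S1: "S \<subseteq> S1" "derivable p S1" "triple (prog_encode a) x y \<in> S1"
    using Prec_0 by blast
  show ?case
    by (rule derivable_step[OF S1(2) derives_Prec_0[OF S1(3)] S1(1)])
next
  case (Prec_Suc a b x k y z)
  obtain S1 where S1: "S \<subseteq> S1" "derivable p S1"
    "triple (prog_encode (Prec a b)) (code x k) y \<in> S1" 
    using Prec_Suc.IH(1) Prec_Suc.prems by blast
  obtain S2 where S2: "S1 \<subseteq> S2" "derivable p S2"
    "triple (prog_encode b) (code x (code k y)) z \<in> S2" 
    using Prec_Suc.IH(2) S1(2) by blast
  show ?case
    by (rule derivable_step[OF S2(2) derives_Prec_Suc[OF _ S2(3)]]) (use S1 S2 in auto)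
next
  case (Mu a x k)
  \<comment> \<open>The premises of the minimization rule are added one by one, up to every bound not above the result.\<close>
  have "\<exists>S'. S \<subseteq> S' \<and> derivable p S' \<and>
      (\<forall>j<l. \<exists>y. triple (prog_encode a) (code x j) (Suc y) \<in> S')"
    if "l \<le> k" for l
    using that
  proof (induction l)
    case 0
    then show ?case using Mu.prems by auto
  next
    case (Suc l)
    then obtain S1 where S1: "S \<subseteq> S1" "derivable p S1"
      "\<forall>j<l. \<exists>y. triple (prog_encode a) (code x j) (Suc y) \<in> S1" by auto
    have "l < k" using Suc.prems by simp
    then obtain y S2 where S2: "S1 \<subseteq> S2" "derivable p S2"
      "triple (prog_encode a) (code x l) (Suc y) \<in> S2" using Mu.IH(2) S1(2) by blast
    have "\<forall>j<Suc l. \<exists>y. triple (prog_encode a) (code x j) (Suc y) \<in> S2"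
      using S1(3) S2(1,3) unfolding less_Suc_eq by blast
    then show ?case using S1(1) S2(1,2) by (intro exI[of _ S2]) auto
  qed
  from this[of k] obtain S1 where S1: "S \<subseteq> S1" "derivable p S1"
    "\<forall>j<k. \<exists>y. triple (prog_encode a) (code x j) (Suc y) \<in> S1" by auto
  obtain S2 where S2: "S1 \<subseteq> S2" "derivable p S2" "triple (prog_encode a) (code x k) 0 \<in> S2"
    using Mu.IH(1) S1(2) by blast
  have "derives p S2 (prog_encode (Mu a)) x k"
    using S1(3) S2(1) by (intro derives_Mu S2(3)) blast
  from derivable_step[OF S2(2) this] show ?case using S1(1) S2(1) by (meson subset_trans)
next
  case (Zero x)
  have "derives p S (prog_encode Zero) x 0" by (simp add: derives_def)
  from derivable_step[OF Zero.prems this subset_refl] show ?case .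
next
  case (Succ x)
  have "derives p S (prog_encode Succ) x (Suc x)" by (simp add: derives_def)
  from derivable_step[OF Succ.prems this subset_refl] show ?case .
next
  case (Fst x)
  have "derives p S (prog_encode Fst) x (pr1 x)" by (simp add: derives_def)
  from derivable_step[OF Fst.prems this subset_refl] show ?case .
next
  case (Snd x)
  have "derives p S (prog_encode Snd) x (pr2 x)" by (simp add: derives_def)
  from derivable_step[OF Snd.prems this subset_refl] show ?case .
next
  case (Oracle x)
  have "derives p S (prog_encode Oracle) x (p x)" by (simp add: derives_def)
  from derivable_step[OF Oracle.prems this subset_refl] show ?case .
qed

text \<open>Every number codes an infinite sequence by repeated unpairing. Arbitrary finite initial segments
  occur (\<open>entry_surj\<close>), and there is no need to treat lengths as part of the code.\<close>

definition entry :: "nat \<Rightarrow> nat \<Rightarrow> nat" where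
  "entry z i = pr1 (rec_nat z (\<lambda>_ y. pr2 y) i)"

lemma entry_code [simp]: "entry (code a z) 0 = a" "entry (code a z) (Suc i) = entry z i"
proof -
  have "rec_nat (code a z) (\<lambda>_ y. pr2 y) (Suc i) = rec_nat z (\<lambda>_ y. pr2 y) i" for i
    by (induction i) auto
  then show "entry (code a z) (Suc i) = entry z i" unfolding entry_def by presburger
qed (simp add: entry_def)

lemma entry_surj: "\<exists>z. \<forall>i<l. entry z i = t i"
proof (induction l arbitrary: t)
  case (Suc l)
  from Suc[of "\<lambda>i. t (Suc i)"] obtain z where "\<forall>i<l. entry z i = t (Suc i)" by blast
  then have "\<forall>i<Suc l. entry (code (t 0) z) i = t i"
    by (auto simp: less_Suc_eq_0_disj)
  then show ?case by blast
qed simp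

lemma rec_entry [rec_intros]:
  "rec_fun f \<Longrightarrow> rec_fun g \<Longrightarrow> rec_fun (\<lambda>p x. entry (f p x) (g p x))"
  unfolding entry_def by (intro rec_intros)

text \<open>The witness \<open>w\<close> is the triple of the output, the index of the last step, and a code of the
  derivation; this is Kleene's \<open>T\<close> predicate.\<close>

definition computation :: "baire \<Rightarrow> nat \<Rightarrow> nat \<Rightarrow> nat \<Rightarrow> bool" where
  "computation p c x w \<longleftrightarrow>
    derivation p (entry (pr2 (pr2 w))) (Suc (pr1 (pr2 w))) \<and>
    entry (pr2 (pr2 w)) (pr1 (pr2 w)) = triple c x (pr1 w)"

lemma computation_sound:
  assumes "computation p c x w" shows "eval p (prog_decode c) x (pr1 w)"
  using derivation_sound[of p "entry (pr2 (pr2 w))" "Suc (pr1 (pr2 w))" "pr1 (pr2 w)"] assms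
  by (simp add: computation_def)

lemma computation_complete:
  assumes "eval p (prog_decode c) x y" shows "\<exists>w. computation p c x w \<and> pr1 w = y"
proof -
  have "derivable p {}" unfolding derivable_def derivation_def by (rule exI, rule exI[of _ 0]) simp
  from eval_derivable[OF assms this] obtain t l j
    where t: "derivation p t l" "triple c x y = t j" "j < l" by (auto simp: derivable_def)
  obtain z where z: "entry z i = t i" if "i < l" for i using entry_surj by blast
  have "entry z ` {..<i} = t ` {..<i}" if "i < l" for i
    using z that by (intro image_cong) auto
  then have "derivation p (entry z) (Suc j)"
    using t z by (auto simp: derivation_def)
  then have "computation p c x (code y (code j z))"
    using t(2,3) z by (simp add: computation_def)
  then show ?thesis by (metis fst_conv prod_encode_inverse)
qed

lemma rec_mem_entries [rec_intros]:
  assumes "rec_fun u" "rec_fun f" "rec_fun g"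
  shows "rec_rel (\<lambda>p x. u p x \<in> entry (f p x) ` {..<g p x})"
proof (rule rec_rel_eq)
  show "rec_rel (\<lambda>p x. \<exists>i<g p x. u p x = entry (f p x) i)"
    by (intro rec_intros assms rec_comp[OF assms(1)] rec_comp[OF assms(2)])
qed auto

lemma rec_bex_entries [rec_intros]:
  assumes "rec_rel (\<lambda>p z. P p (pr1 z) (pr2 z))" "rec_fun f" "rec_fun g"
  shows "rec_rel (\<lambda>p x. \<exists>e\<in>entry (f p x) ` {..<g p x}. P p x e)"
proof (rule rec_rel_eq)
  have P: "rec_rel (\<lambda>p z. P p (pr1 z) (entry (f p (pr1 z)) (pr2 z)))"
    using rec_comp2[OF assms(1)[unfolded rec_rel_def], of "\<lambda>p z. pr1 z"
        "\<lambda>p z. entry (f p (pr1 z)) (pr2 z)"] unfolding rec_rel_def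
    by (simp add: rec_intros rec_comp[OF assms(2)])
  show "rec_rel (\<lambda>p x. \<exists>i<g p x. P p x (entry (f p x) i))"
    by (intro rec_intros assms P)
qed auto

text \<open>The simulated oracle \<open>q p v\<close> may itself depend on parameters: computations relative to all
  staircases are checked by one program.\<close>

lemma rec_computation [rec_intros]:
  assumes q: "rec_fun (\<lambda>p z. q p (pr1 z) (pr2 z))" and "rec_fun c" "rec_fun x" "rec_fun w"
  shows "rec_rel (\<lambda>p v. computation (q p v) (c p v) (x p v) (w p v))"
proof -
  note comps = rec_comp2[OF q] assms(2-4)[THEN rec_comp]
  show ?thesis
    unfolding computation_def derivation_def derives_def triple_def
    by (intro rec_intros comps assms(2-4))
qed

section \<open>Staircases and levels\<close>

definition blocks :: "nat list \<Rightarrow> nat \<Rightarrow> nat list" where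
  "blocks \<sigma> m = concat (map (\<lambda>k. replicate (\<sigma> ! k) k) [0..<m])"

lemma set_blocks: "x \<in> set (blocks \<sigma> m) \<Longrightarrow> x < m"
  by (auto simp: blocks_def)

lemma sorted_blocks: "sorted (blocks \<sigma> m)"
proof (induction m)
  case (Suc m)
  then show ?case
    using set_blocks[of _ \<sigma> m] by (fastforce simp: blocks_def sorted_append)
qed (simp add: blocks_def)

lemma blocks_cong: "(\<And>k. k < m \<Longrightarrow> \<sigma> ! k = \<tau> ! k) \<Longrightarrow> blocks \<sigma> m = blocks \<tau> m"
  unfolding blocks_def by (intro arg_cong[of _ _ concat] map_cong) auto

lemma staircase_blocks: "staircase m = {conc (blocks \<sigma> m) (\<lambda>_. m) | \<sigma>. length \<sigma> = m}"
  by (simp add: staircase_def blocks_def)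

text \<open>By induction on the final value: before the top step begins, the sequence is a shorter staircase,
  whose own last step becomes an explicit block.\<close>

lemma staircase_mono_eventually:
  "mono q \<Longrightarrow> (\<forall>x\<ge>N. q x = m) \<Longrightarrow> q \<in> staircase m"
proof (induction m arbitrary: q N)
  case 0
  have "q x = 0" for x
    using monoD[OF 0(1), of x "max x N"] 0(2) by simp
  then have "q = (\<lambda>_. 0)" by auto
  then show ?case by (simp add: staircase_def)
next
  case (Suc m)
  have le: "q x \<le> Suc m" for x
    using monoD[OF Suc.prems(1), of x "max x N"] Suc.prems(2) by simp
  \<comment> \<open>\<open>L\<close> is the position at which the top step begins.\<close>
  define L where "L = (LEAST x. q x = Suc m)"
  have L: "q L = Suc m" unfolding L_def by (rule LeastI[of _ N]) (use Suc.prems(2) in simp)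
  have top: "q x = Suc m" if "L \<le> x" for x
    using monoD[OF Suc.prems(1) that] L le[of x] by simp
  have below: "q x \<le> m" if "x < L" for x
    using not_less_Least[of x "\<lambda>x. q x = Suc m"] that le[of x] unfolding L_def by simp
  define r where "r x = (if x < L then q x else m)" for x
  have "mono r"
    unfolding r_def using monoD[OF Suc.prems(1)] below by (auto intro!: monoI)
  then have "r \<in> staircase m"
    by (rule Suc.IH[of r L]) (simp add: r_def)
  then obtain \<sigma> where \<sigma>: "r = conc (blocks \<sigma> m) (\<lambda>_. m)" "length \<sigma> = m"
    by (auto simp: staircase_blocks)
  have len: "length (blocks \<sigma> m) \<le> L"
  proof (rule ccontr)
    assume *: "\<not> length (blocks \<sigma> m) \<le> L"
    then have "r L < m" using \<sigma>(1) set_blocks[OF nth_mem] by (simp add: conc_def)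
    then show False by (simp add: r_def)
  qed
  define \<tau> where "\<tau> = \<sigma> @ [L - length (blocks \<sigma> m)]"
  have "blocks \<tau> (Suc m) = blocks \<tau> m @ replicate (\<tau> ! m) m"
    by (simp add: blocks_def)
  also have "blocks \<tau> m = blocks \<sigma> m"
    by (rule blocks_cong) (simp add: \<tau>_def nth_append \<sigma>(2))
  also have "\<tau> ! m = L - length (blocks \<sigma> m)" by (simp add: \<tau>_def nth_append \<sigma>(2))
  finally have \<tau>: "blocks \<tau> (Suc m) = blocks \<sigma> m @ replicate (L - length (blocks \<sigma> m)) m" .
  have "q x = conc (blocks \<tau> (Suc m)) (\<lambda>_. Suc m) x" for x
  proof (cases "x < L")
    case True
    then have "q x = conc (blocks \<sigma> m) (\<lambda>_. m) x"
      using fun_cong[OF \<sigma>(1), of x] by (simp add: r_def)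
    then show ?thesis using True len unfolding \<tau> by (auto simp: conc_def nth_append)
  next
    case False
    then show ?thesis using top[of x] len unfolding \<tau> by (simp add: conc_def)
  qed
  then show ?case
    unfolding staircase_blocks using \<sigma>(2) by (auto simp: \<tau>_def intro!: exI[of _ \<tau>])
qed

lemma staircase_iff: "q \<in> staircase m \<longleftrightarrow> mono q \<and> (\<exists>N. \<forall>x\<ge>N. q x = m)"
proof
  assume "q \<in> staircase m"
  then obtain \<sigma> where q: "q = conc (blocks \<sigma> m) (\<lambda>_. m)" by (auto simp: staircase_blocks)
  have "mono q"
  proof (rule monoI)
    fix x y :: nat assume "x \<le> y"
    then show "q x \<le> q y"
      using sorted_nth_mono[OF sorted_blocks, of x y \<sigma> m] set_blocks[OF nth_mem, of x \<sigma> m]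
      by (auto simp: q conc_def)
  qed
  moreover have "\<forall>x\<ge>length (blocks \<sigma> m). q x = m" by (simp add: q conc_def)
  ultimately show "mono q \<and> (\<exists>N. \<forall>x\<ge>N. q x = m)" by blast
qed (auto intro: staircase_mono_eventually)

lemma staircase_nonempty: "staircase m \<noteq> {}"
proof -
  have "(\<lambda>_. m) \<in> staircase m" by (simp add: staircase_iff mono_def)
  then show ?thesis by blast
qed

lemma staircase_le: "q \<in> staircase m \<Longrightarrow> q x \<le> m"
proof -
  assume "q \<in> staircase m"
  then obtain N where "mono q" "\<forall>x\<ge>N. q x = m" by (auto simp: staircase_iff)
  then show "q x \<le> m" using monoD[of q x "max x N"] by simp
qed

lemma staircase_attained: "q \<in> staircase m \<Longrightarrow> \<exists>x. q x = m"
  by (auto simp: staircase_iff)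

definition level :: "nat \<Rightarrow> baire \<Rightarrow> nat" where
  "level n p = (LEAST k. k = n \<or> (\<exists>\<^sub>\<infinity>j. p j = k))"

lemma level_le: "level n p \<le> n"
  unfolding level_def by (rule Least_le) simp

lemma level_inf: "level n p < n \<Longrightarrow> \<exists>\<^sub>\<infinity>j. p j = level n p"
  using LeastI[of "\<lambda>k. k = n \<or> (\<exists>\<^sub>\<infinity>j. p j = k)" n] unfolding level_def by fastforce

lemma level_least: "(\<exists>\<^sub>\<infinity>j. p j = k) \<Longrightarrow> level n p \<le> k"
  unfolding level_def by (rule Least_le) simp

lemma g_problem_level: "g_problem n p = staircase (level n p)"
proof (cases "inf_often p n = {}")
  case True
  then have "\<not> level n p < n"
    using level_inf[of n p] unfolding inf_often_def by blast
  then have "level n p = n" using level_le[of n p] by simp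
  then show ?thesis using True by (simp add: g_problem_def)
next
  case False
  have fin: "finite (inf_often p n)" by (simp add: inf_often_def)
  have "Min (inf_often p n) = level n p"
  proof (rule antisym)
    obtain k where "k < n" "\<exists>\<^sub>\<infinity>j. p j = k" using False by (auto simp: inf_often_def)
    then have "level n p \<in> inf_often p n"
      using level_least[of p k n] level_inf[of n p] by (simp add: inf_often_def)
    then show "Min (inf_often p n) \<le> level n p" by (rule Min_le[OF fin])
  next
    show "level n p \<le> Min (inf_often p n)"
      using Min_in[OF fin False] by (simp add: inf_often_def level_least)
  qed
  then show ?thesis using False by (simp add: g_problem_def)
qed

lemma g_problem_nonempty: "g_problem n p \<noteq> {}"
  by (simp add: g_problem_level staircase_nonempty)

section \<open>Reductions and monotonicity of the tot-jump\<close>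

text \<open>The components of a pair of sequences; doubling is written as \<open>x + x\<close> to stay within addition.\<close>

definition left :: "baire \<Rightarrow> baire" where "left p = (\<lambda>x. p (x + x))"
definition right :: "baire \<Rightarrow> baire" where "right p = (\<lambda>x. p (Suc (x + x)))"

lemma left_pair [simp]: "left (pair p q) = p" and right_pair [simp]: "right (pair p q) = q"
  by (simp_all add: left_def right_def)

lemma rec_left [rec_intros]: "rec_fun f \<Longrightarrow> rec_fun (\<lambda>p x. left p (f p x))"
  and rec_right [rec_intros]: "rec_fun f \<Longrightarrow> rec_fun (\<lambda>p x. right p (f p x))"
  unfolding left_def right_def by (intro rec_intros; assumption)+

definition reduces :: "prog \<Rightarrow> prog \<Rightarrow> problem \<Rightarrow> problem \<Rightarrow> bool" where
  "reduces a b f g \<longleftrightarrow> (\<forall>p. f p \<noteq> {} \<longrightarrow> (\<exists>p'. functional a p = Some p' \<and> g p' \<noteq> {} \<and>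
    (\<forall>q\<in>g p'. \<exists>r. functional b (pair p q) = Some r \<and> r \<in> f p)))"

lemma reducesI:
  assumes "\<And>p. f p \<noteq> {} \<Longrightarrow> functional a p = Some (F p)"
    "\<And>p. f p \<noteq> {} \<Longrightarrow> g (F p) \<noteq> {}"
    "\<And>p q. f p \<noteq> {} \<Longrightarrow> q \<in> g (F p) \<Longrightarrow> \<exists>r. functional b (pair p q) = Some r \<and> r \<in> f p"
  shows "reduces a b f g"
  unfolding reduces_def
proof (intro allI impI)
  fix p assume "f p \<noteq> {}"
  note F = assms[OF this]
  then show "\<exists>p'. functional a p = Some p' \<and> g p' \<noteq> {} \<and>
      (\<forall>q\<in>g p'. \<exists>r. functional b (pair p q) = Some r \<and> r \<in> f p)"
    by (intro exI[of _ "F p"]) simp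
qed

lemma reducesD:
  "reduces a b f g \<Longrightarrow> f p \<noteq> {} \<Longrightarrow> \<exists>p'. functional a p = Some p' \<and> g p' \<noteq> {} \<and>
    (\<forall>q\<in>g p'. \<exists>r. functional b (pair p q) = Some r \<and> r \<in> f p)"
  unfolding reduces_def by blast

text \<open>Passing from functionals to the programs that compute them makes reductions available for
  composition by substitution.\<close>

lemma weihrauch_le_iff: "f \<le>\<^sub>W g \<longleftrightarrow> (\<exists>a b. reduces a b f g)"
proof
  assume "f \<le>\<^sub>W g"
  then obtain F G where "computable F" "computable2 G" and FG: "\<forall>p\<in>pdom f. \<exists>p'. F p = Some p' \<and>
      p' \<in> pdom g \<and> (\<forall>q\<in>g p'. \<exists>r. G p q = Some r \<and> r \<in> f p)"
    unfolding weihrauch_le_def by blast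
  then obtain a b where "F = functional a" "\<And>p q. G p q = functional b (pair p q)"
    unfolding computable_def computable2_def by blast
  then show "\<exists>a b. reduces a b f g" using FG unfolding reduces_def pdom_def by auto
next
  assume "\<exists>a b. reduces a b f g"
  then obtain a b where "reduces a b f g" by blast
  moreover have "computable (functional a)" by (auto simp: computable_def)
  moreover have "computable2 (\<lambda>p q. functional b (pair p q))"
    by (auto simp: computable2_def computable_def intro!: exI[of _ "functional b"])
  ultimately show "f \<le>\<^sub>W g"
    unfolding weihrauch_le_def reduces_def pdom_def
    by (intro exI[of _ "functional a"] exI[of _ "\<lambda>p q. functional b (pair p q)"]) auto
qed

text \<open>The common part of composing reductions: the answer \<open>q\<close> to the inner question is translated by
  \<open>b\<close> in the presence of the translated instance \<open>a(p)\<close>, while the original instance is kept for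
  the outer translation.\<close>

lemma functional_compose_inner:
  "\<exists>c. \<forall>p q p' q'. functional a p = Some p' \<longrightarrow> functional b (pair p' q) = Some q' \<longrightarrow>
    functional c (pair p q) = Some (pair p q')"
proof -
  have "rec_fun left" "rec_fun right" by (intro rec_left rec_right rec_id)+
  then obtain l r where l: "\<And>p. functional l p = Some (left p)"
    and r: "\<And>p. functional r p = Some (right p)"
    using rec_functional by metis
  obtain s where s: "\<And>p q r'. functional (subst l a) p = Some q \<Longrightarrow> functional r p = Some r' \<Longrightarrow>
    functional s p = Some (pair q r')" using functional_pair by blast
  obtain t where t: "\<And>p q r. functional l p = Some q \<Longrightarrow> functional (subst s b) p = Some r \<Longrightarrow>
    functional t p = Some (pair q r)" using functional_pair by blast
  have "functional t (pair p q) = Some (pair p q')"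
    if "functional a p = Some p'" "functional b (pair p' q) = Some q'" for p q p' q'
  proof (rule t)
    show "functional l (pair p q) = Some p" by (simp add: l)
    have "functional (subst l a) (pair p q) = Some p'"
      by (rule functional_subst[OF l]) (simp add: that(1))
    moreover have "functional r (pair p q) = Some q" by (simp add: r)
    ultimately show "functional (subst s b) (pair p q) = Some q'"
      using functional_subst[OF s that(2)] by blast
  qed
  then show ?thesis by blast
qed

lemma weihrauch_le_trans:
  assumes "f \<le>\<^sub>W g" "g \<le>\<^sub>W h" shows "f \<le>\<^sub>W h"
proof -
  obtain a b a' b' where ab: "reduces a b f g" and ab': "reduces a' b' g h"
    using assms weihrauch_le_iff by blast
  obtain c where c: "\<And>p q p' q'. functional a p = Some p' \<Longrightarrow> functional b' (pair p' q) = Some q' \<Longrightarrow>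
    functional c (pair p q) = Some (pair p q')" using functional_compose_inner by blast
  have "reduces (subst a a') (subst c b) f h"
    unfolding reduces_def
  proof (intro allI impI)
    fix p assume "f p \<noteq> {}"
    then obtain p' where p': "functional a p = Some p'" "g p' \<noteq> {}"
      "\<And>q. q \<in> g p' \<Longrightarrow> \<exists>r. functional b (pair p q) = Some r \<and> r \<in> f p" using reducesD[OF ab] by meson
    obtain p'' where p'': "functional a' p' = Some p''" "h p'' \<noteq> {}"
      "\<And>q. q \<in> h p'' \<Longrightarrow> \<exists>r. functional b' (pair p' q) = Some r \<and> r \<in> g p'"
      using reducesD[OF ab' p'(2)] by meson
    have "\<exists>r. functional (subst c b) (pair p q) = Some r \<and> r \<in> f p" if q: "q \<in> h p''" for q
    proof -
      obtain q' where q': "functional b' (pair p' q) = Some q'" "q' \<in> g p'"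
        using p''(3)[OF q] by blast
      obtain r where r: "functional b (pair p q') = Some r" "r \<in> f p" using p'(3)[OF q'(2)] by blast
      show ?thesis using functional_subst[OF c[OF p'(1) q'(1)] r(1)] r(2) by blast
    qed
    then show "\<exists>p''. functional (subst a a') p = Some p'' \<and> h p'' \<noteq> {} \<and>
      (\<forall>q\<in>h p''. \<exists>r. functional (subst c b) (pair p q) = Some r \<and> r \<in> f p)"
      using functional_subst[OF p'(1) p''(1)] p''(2) by blast
  qed
  then show ?thesis using weihrauch_le_iff by blast
qed

lemma Phi_decode: "Phi e = functional (prog_decode e)"
  by (simp add: Phi_def prog_decode_def)

lemma Phi_encode [simp]: "Phi (prog_encode c) = functional c"
  by (simp add: Phi_decode)

lemma Phi_eq_Some_iff: "Phi e p = Some q \<longleftrightarrow> (\<forall>x. eval p (prog_decode e) x (q x))"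
  by (simp add: Phi_decode functional_eq_Some_iff)

lemma Phi_neq_None_iff: "Phi e p \<noteq> None \<longleftrightarrow> (\<forall>x. \<exists>y. eval p (prog_decode e) x y)"
  by (simp add: Phi_decode functional_def)

lemma computation_value: "Phi e p = Some q \<Longrightarrow> computation p e x w \<Longrightarrow> pr1 w = q x"
  using computation_sound eval_deterministic by (metis Phi_eq_Some_iff)

lemma computation_exists: "Phi e p = Some q \<Longrightarrow> \<exists>w. computation p e x w"
  using computation_complete by (metis Phi_eq_Some_iff)

text \<open>The code of the program to be simulated is the first entry of the oracle. Which derivation is
  found does not matter, as all of them have the same output.\<close>

lemma universal_program:
  "\<exists>u. \<forall>e p q. Phi e p = Some q \<longrightarrow> functional u (case_nat e p) = Some q"
proof -
  have "rec_rel (\<lambda>p z. computation (\<lambda>x. p (Suc x)) (p 0) (pr1 z) (pr2 z))"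
    "rec_fun (\<lambda>p z. pr1 (pr2 z))" by (intro rec_intros)+
  then obtain u where u: "\<And>p x w. computation (\<lambda>x. p (Suc x)) (p 0) x w \<Longrightarrow>
      eval p u x (pr1 (LEAST w. computation (\<lambda>x. p (Suc x)) (p 0) x w))"
    using search[of "\<lambda>p. computation (\<lambda>x. p (Suc x)) (p 0)" "\<lambda>p x w. pr1 w"] by blast
  have "functional u (case_nat e p) = Some q" if Phi: "Phi e p = Some q" for e p q
    unfolding functional_eq_Some_iff
  proof
    fix x
    obtain w where w: "computation p e x w" using computation_exists[OF Phi] by blast
    then have "pr1 (LEAST w. computation p e x w) = q x"
      by (rule computation_value[OF Phi LeastI])
    then show "eval (case_nat e p) u x (q x)"
      using u[of "case_nat e p" x w] w by simp
  qed
  then show ?thesis by blast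
qed

lemma tot_jump_at_total:
  assumes "Phi e p = Some p'" "f p' \<noteq> {}" "\<And>q. q \<in> f p' \<Longrightarrow> Phi i (pair p q) \<noteq> None"
  shows "tot_jump_at f e i p = {r. \<exists>q\<in>f p'. Phi i (pair p q) = Some r}"
proof -
  have "\<exists>p'. Phi e p = Some p' \<and> p' \<in> pdom f \<and> (\<forall>q\<in>f p'. Phi i (pair p q) \<noteq> None)"
    using assms by (simp add: pdom_def)
  then show ?thesis using assms(1) by (simp add: tot_jump_at_def)
qed

lemma tot_jump_nonempty: "tot_jump f r \<noteq> {}"
  by (auto simp: tot_jump_def tot_jump_at_def pdom_def)

text \<open>The coding of instances of the tot-jump as sequences.\<close>

definition cons2 :: "nat \<Rightarrow> nat \<Rightarrow> baire \<Rightarrow> baire" where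
  "cons2 e i p = case_nat e (case_nat i p)"

lemma tot_jump_cons2: "tot_jump f (cons2 e i p) = tot_jump_at f e i p"
  by (simp add: tot_jump_def cons2_def)

lemma functional_cons2:
  "\<exists>c. \<forall>p. functional c p = Some (cons2 e i p)"
proof -
  have "rec_fun (cons2 e i)"
    unfolding cons2_def by (intro rec_intros)
  then show ?thesis using rec_functional by blast
qed

text \<open>The two programs \<open>e\<close> and \<open>i\<close> of the new instance are fixed; the old programs are part of its
  oracle and are simulated. The new inner question is the translation of the old one, and the new
  outer functional translates the answer back before it applies the old one. If the side condition
  holds for the old instance, it therefore holds for the new one, and the jump's answers are
  answers to the old instance; otherwise every sequence is one.\<close>

lemma tot_jump_mono:
  assumes "f \<le>\<^sub>W g" shows "tot_jump f \<le>\<^sub>W tot_jump g"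
proof -
  obtain a b where ab: "reduces a b f g" using assms weihrauch_le_iff by blast
  obtain u where u: "\<And>e p q. Phi e p = Some q \<Longrightarrow> functional u (case_nat e p) = Some q"
    using universal_program by blast
  have "rec_fun (\<lambda>r. case_nat (r 0) (\<lambda>n. r (n + 2)))" by (intro rec_intros)
  then obtain s where s: "\<And>r. functional s r = Some (case_nat (r 0) (\<lambda>n. r (n + 2)))"
    using rec_functional by blast
  have "rec_fun (\<lambda>o'. case_nat (left o' 1) (pair (\<lambda>n. left o' (n + 2)) (right o')))"
    by (intro rec_intros)
  then obtain t where t: "\<And>o'. functional t o' =
      Some (case_nat (left o' 1) (pair (\<lambda>n. left o' (n + 2)) (right o')))"
    using rec_functional by blast
  have su: "functional (subst s u) r = Some p'" if "Phi (r 0) (\<lambda>n. r (n + 2)) = Some p'" for r p'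
    by (rule functional_subst[OF s u[OF that]])
  obtain c where c: "\<And>p q p' q'. functional (subst s u) p = Some p' \<Longrightarrow>
      functional b (pair p' q) = Some q' \<Longrightarrow> functional c (pair p q) = Some (pair p q')"
    using functional_compose_inner by blast
  define e where "e = prog_encode (subst (subst s u) a)"
  define i where "i = prog_encode (subst c (subst t u))"
  obtain d where d: "\<And>p. functional d p = Some (cons2 e i p)" using functional_cons2 by blast
  have "rec_fun right" by (intro rec_intros)
  then obtain k where k: "\<And>p. functional k p = Some (right p)" using rec_functional by metis
  have main: "tot_jump_at g e i r \<subseteq> tot_jump f r" for r
  proof (cases "\<exists>p'. Phi (r 0) (\<lambda>n. r (n + 2)) = Some p' \<and> p' \<in> pdom f \<and>
      (\<forall>q\<in>f p'. Phi (r 1) (pair (\<lambda>n. r (n + 2)) q) \<noteq> None)")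
    case True
    then obtain p' where p': "Phi (r 0) (\<lambda>n. r (n + 2)) = Some p'" "f p' \<noteq> {}"
      "\<And>q. q \<in> f p' \<Longrightarrow> Phi (r 1) (pair (\<lambda>n. r (n + 2)) q) \<noteq> None"
      by (auto simp: pdom_def)
    obtain p'' where p'': "functional a p' = Some p''" "g p'' \<noteq> {}"
      "\<And>q. q \<in> g p'' \<Longrightarrow> \<exists>r. functional b (pair p' q) = Some r \<and> r \<in> f p'"
      using reducesD[OF ab p'(2)] by meson
    have e: "Phi e r = Some p''"
      unfolding e_def Phi_encode by (rule functional_subst[OF su[OF p'(1)] p''(1)])
    have i: "\<exists>q'\<in>f p'. \<exists>y. Phi i (pair r q) = Some y \<and> Phi (r 1) (pair (\<lambda>n. r (n + 2)) q') = Some y"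
      if q: "q \<in> g p''" for q
    proof -
      obtain q' where q': "functional b (pair p' q) = Some q'" "q' \<in> f p'"
        using p''(3)[OF q] by blast
      obtain y where y: "Phi (r 1) (pair (\<lambda>n. r (n + 2)) q') = Some y" using p'(3)[OF q'(2)] by blast
      have "functional (subst t u) (pair r q') = Some y"
        by (rule functional_subst[OF t]) (simp only: left_pair right_pair u[OF y])
      from functional_subst[OF c[OF su[OF p'(1)] q'(1)] this] show ?thesis
        unfolding i_def Phi_encode using q'(2) y by blast
    qed
    have "tot_jump f r = {y. \<exists>q\<in>f p'. Phi (r 1) (pair (\<lambda>n. r (n + 2)) q) = Some y}"
      unfolding tot_jump_def by (rule tot_jump_at_total[where f = f, OF p'])
    moreover have "tot_jump_at g e i r = {y. \<exists>q\<in>g p''. Phi i (pair r q) = Some y}"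
      using i by (intro tot_jump_at_total[where f = g, OF e p''(2)]) fastforce
    ultimately show ?thesis using i by fastforce
  next
    case False
    then have "tot_jump f r = UNIV" unfolding tot_jump_def tot_jump_at_def by (rule if_not_P)
    then show ?thesis by simp
  qed
  have "reduces d k (tot_jump f) (tot_jump g)"
  proof (rule reducesI[where F = "cons2 e i"])
    fix r
    show "functional d r = Some (cons2 e i r)" by (rule d)
    show "tot_jump g (cons2 e i r) \<noteq> {}" by (rule tot_jump_nonempty)
    fix q assume "q \<in> tot_jump g (cons2 e i r)"
    then have "q \<in> tot_jump f r" using main unfolding tot_jump_cons2 by blast
    then show "\<exists>y. functional k (pair r q) = Some y \<and> y \<in> tot_jump f r" by (simp add: k)
  qed
  then show ?thesis using weihrauch_le_iff by blast
qed

section \<open>Reducing the next problem to the jump\<close>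

text \<open>Entries of a staircase below its final value always satisfy the second alternative. Entries equal
  to the final value can only satisfy the first one, and all of them do so iff \<open>p\<close> takes that value
  infinitely often.\<close>

definition certified :: "baire \<Rightarrow> baire \<Rightarrow> nat \<Rightarrow> nat \<Rightarrow> bool" where
  "certified p q x w \<longleftrightarrow> x \<le> w \<and> p w = q x \<or> q x < q w"

lemma certified_ex:
  assumes "q \<in> staircase m" "\<exists>\<^sub>\<infinity>j. p j = m"
  shows "\<exists>w. certified p q x w"
proof (cases "q x = m")
  case True
  then show ?thesis using assms(2) by (auto simp: INFM_nat_le certified_def)
next
  case False
  then have "q x < m" using staircase_le[OF assms(1), of x] by simp
  then show ?thesis using staircase_attained[OF assms(1)] by (auto simp: certified_def)
qed

lemma mono_bounded_eventually_const:
  fixes q :: baire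
  assumes "mono q" "\<And>x. q x \<le> n"
  obtains k N where "k \<le> n" "\<And>x. q x \<le> k" "\<And>x. N \<le> x \<Longrightarrow> q x = k"
proof -
  have fin: "finite (range q)" by (rule finite_subset[of _ "{..n}"]) (use assms(2) in auto)
  define k where "k = Max (range q)"
  have le: "q x \<le> k" for x unfolding k_def by (rule Max_ge[OF fin]) simp
  have "k \<in> range q" unfolding k_def by (rule Max_in[OF fin]) simp
  then obtain N where N: "k = q N" by blast
  show ?thesis
  proof
    show "k \<le> n" using N assms(2) by simp
    show "q x \<le> k" for x by (rule le)
    show "q x = k" if "N \<le> x" for x using monoD[OF assms(1) that] le[of x] N by simp
  qed
qed

text \<open>The values of a bounded nondecreasing sequence stabilize, say at \<open>k\<close>; from then on no certificate
  can point to a larger value, so the positions of \<open>k\<close> in \<open>p\<close> are unbounded.\<close>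

lemma certified_inf:
  assumes "mono q" "\<And>x. q x \<le> n" "\<And>x. \<exists>w. certified p q x w"
  shows "\<exists>k\<le>n. \<exists>\<^sub>\<infinity>j. p j = k"
proof -
  obtain k N where k: "k \<le> n" "\<And>x. q x \<le> k" "\<And>x. N \<le> x \<Longrightarrow> q x = k"
    using mono_bounded_eventually_const[OF assms(1,2)] by blast
  have "\<exists>j\<ge>x. p j = k" for x
  proof -
    obtain w where "certified p q (max x N) w" using assms(3) by blast
    moreover have "q (max x N) = k" "q w \<le> k" using k by auto
    ultimately have "max x N \<le> w" "p w = k" by (auto simp: certified_def)
    then show ?thesis by auto
  qed
  then show ?thesis using k(1) by (auto simp: INFM_nat_le)
qed

text \<open>The answer \<open>r\<close> claims to consist of the entries of a staircase, each paired with a certificate.\<close>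

definition plausible :: "nat \<Rightarrow> baire \<Rightarrow> baire \<Rightarrow> nat \<Rightarrow> bool" where
  "plausible n p r y \<longleftrightarrow> pr1 (r y) \<le> n \<and> pr1 (r y) \<le> pr1 (r (Suc y)) \<and>
     certified p (\<lambda>x. pr1 (r x)) y (pr2 (r y))"

text \<open>Only finitely many claims are checked before an entry is produced, so that the output is total.
  From the first refuted claim on, it is \<open>Suc n\<close>.\<close>

definition repair :: "nat \<Rightarrow> baire \<Rightarrow> baire \<Rightarrow> baire" where
  "repair n p r x = (if \<forall>y<Suc x. plausible n p r y then pr1 (r x) else Suc n)"

lemma repair_plausible:
  assumes "\<And>y. plausible n p r y" shows "repair n p r = (\<lambda>x. pr1 (r x))"
  using assms by (auto simp: repair_def)

lemma repair_garbage:
  assumes "level (Suc n) p = Suc n" shows "repair n p r \<in> staircase (Suc n)"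
proof -
  let ?q = "\<lambda>x. pr1 (r x)"
  have "\<exists>y. \<not> plausible n p r y"
  proof (rule ccontr)
    assume "\<not> ?thesis"
    then have pl: "plausible n p r y" for y by simp
    have "\<exists>k\<le>n. \<exists>\<^sub>\<infinity>j. p j = k"
    proof (rule certified_inf)
      show "mono ?q" using pl by (auto simp: mono_iff_le_Suc plausible_def)
      show "?q x \<le> n" for x using pl[of x] by (simp add: plausible_def)
      show "\<exists>w. certified p ?q x w" for x using pl[of x] by (auto simp: plausible_def)
    qed
    then obtain k where "k \<le> n" "level (Suc n) p \<le> k" using level_least by blast
    then show False using assms by simp
  qed
  then obtain y where y: "\<not> plausible n p r y" by blast
  have top: "repair n p r x = Suc n" if "y \<le> x" for x
    using y that by (auto simp: repair_def less_Suc_eq_le)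
  have "repair n p r x \<le> repair n p r (Suc x)" for x
  proof (cases "\<forall>y<Suc (Suc x). plausible n p r y")
    case True
    then show ?thesis by (auto simp: repair_def plausible_def)
  next
    case False
    then have "repair n p r (Suc x) = Suc n" unfolding repair_def by (rule if_not_P)
    moreover have "repair n p r x \<le> Suc n"
      by (auto simp: repair_def plausible_def less_Suc_eq)
    ultimately show ?thesis by simp
  qed
  then show ?thesis
    using top by (auto simp: staircase_iff mono_iff_le_Suc)
qed

text \<open>If \<open>n\<close> itself is the least value occurring infinitely often, both levels are \<open>n\<close>, for different
  reasons.\<close>

lemma level_Suc: "level (Suc n) p \<le> n \<Longrightarrow> level n p = level (Suc n) p"
proof (rule antisym)
  assume le: "level (Suc n) p \<le> n"
  then show "level n p \<le> level (Suc n) p"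
    using level_inf[of "Suc n" p] by (intro level_least) simp
  show "level (Suc n) p \<le> level n p"
    using le level_inf[of n p] level_le[of n p] level_least[of p "level n p" "Suc n"]
    by (cases "level n p < n") auto
qed

text \<open>The instance of the jump has the identity as its first functional, and its second functional
  searches a certificate for each entry. All searches succeed if some \<open>k \<le> n\<close> occurs infinitely
  often; in the other case nothing is known about the answer, and \<open>repair_garbage\<close> applies.\<close>

lemma g_problem_le_tot_jump: "g_problem (Suc n) \<le>\<^sub>W tot_jump (g_problem n)"
proof -
  let ?w = "\<lambda>p q x. LEAST w. certified p q x w"
  have "rec_rel (\<lambda>p z. certified (left p) (right p) (pr1 z) (pr2 z))"
    unfolding certified_def by (intro rec_intros)
  moreover have "rec_fun (\<lambda>p z. code (right p (pr1 z)) (pr2 z))" by (intro rec_intros)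
  ultimately obtain c where c: "\<And>p x w. certified (left p) (right p) x w \<Longrightarrow>
      eval p c x (code (right p x) (?w (left p) (right p) x))"
    using search[of "\<lambda>p. certified (left p) (right p)" "\<lambda>p x w. code (right p x) w"] by blast
  have "rec_fun (\<lambda>p. repair n (left p) (right p))"
    unfolding repair_def plausible_def certified_def by (intro rec_intros)
  then obtain b where b: "\<And>p. functional b p = Some (repair n (left p) (right p))"
    using rec_functional by blast
  define e where "e = prog_encode Oracle"
  define i where "i = prog_encode c"
  obtain a where a: "\<And>p. functional a p = Some (cons2 e i p)" using functional_cons2 by blast
  have e: "Phi e p = Some p" for p
    unfolding e_def Phi_encode by (simp add: functional_eq_Some_iff eval.Oracle)
  have "repair n p r \<in> g_problem (Suc n) p" if r: "r \<in> tot_jump_at (g_problem n) e i p" for p r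
  proof (cases "level (Suc n) p = Suc n")
    case True
    then show ?thesis by (simp add: g_problem_level repair_garbage)
  next
    case False
    then have le: "level (Suc n) p \<le> n" using level_le[of "Suc n" p] by simp
    have g: "g_problem n p = g_problem (Suc n) p" using level_Suc[OF le] by (simp add: g_problem_level)
    have cert: "\<exists>w. certified p q x w" if "q \<in> g_problem n p" for q x
      using that level_inf[of "Suc n" p] le unfolding g_problem_level level_Suc[OF le]
      by (intro certified_ex[of q "level (Suc n) p"]) simp_all
    have i: "Phi i (pair p q) = Some (\<lambda>x. code (q x) (?w p q x))" if "q \<in> g_problem n p" for q
      unfolding i_def Phi_encode functional_eq_Some_iff
      using c[of "pair p q"] cert[OF that] by simp blast
    have "tot_jump_at (g_problem n) e i p =
        {r. \<exists>q\<in>g_problem n p. Phi i (pair p q) = Some r}"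
      by (rule tot_jump_at_total[OF e g_problem_nonempty]) (simp add: i)
    then obtain q where q: "q \<in> g_problem n p" "r = (\<lambda>x. code (q x) (?w p q x))"
      using r i by auto
    have "plausible n p r y" for y
    proof -
      have "certified p q y (?w p q y)" using cert[OF q(1)] by (rule LeastI_ex)
      moreover have "q y \<le> n"
        using staircase_le[of q _ y] q(1) level_le[of n p] unfolding g_problem_level by fastforce
      moreover have "q y \<le> q (Suc y)"
        using q(1) unfolding g_problem_level staircase_iff mono_iff_le_Suc by blast
      ultimately show ?thesis by (simp add: plausible_def q(2))
    qed
    then have "repair n p r = q" by (simp add: repair_plausible q(2))
    then show ?thesis using q(1) g by simp
  qed
  then have "reduces a b (g_problem (Suc n)) (tot_jump (g_problem n))"
    by (intro reducesI[where F = "cons2 e i"] a tot_jump_nonempty) (simp add: b tot_jump_cons2)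
  then show ?thesis using weihrauch_le_iff by blast
qed

section \<open>Reducing the jump to the next problem\<close>

text \<open>A condition \<open>\<forall>u. \<exists>w. R u w\<close> holds iff there are infinitely many \<open>u\<close> such that all numbers up to
  \<open>u\<close> have witnesses. Counting only the least common bound for these witnesses makes every such \<open>u\<close>
  contribute exactly one pair, so that the number of pairs is infinite precisely when the
  condition holds.\<close>

definition covered :: "(nat \<Rightarrow> nat \<Rightarrow> bool) \<Rightarrow> nat \<Rightarrow> nat \<Rightarrow> bool" where
  "covered R u w \<longleftrightarrow> (\<forall>u'<Suc u. \<exists>w'<Suc w. R u' w')"

definition fresh :: "(nat \<Rightarrow> nat \<Rightarrow> bool) \<Rightarrow> nat \<Rightarrow> nat \<Rightarrow> bool" where
  "fresh R u w \<longleftrightarrow> covered R u w \<and> (\<forall>w'<w. \<not> covered R u w')"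

lemma covered_ex: "\<forall>u. \<exists>w. R u w \<Longrightarrow> \<exists>w. covered R u w"
proof -
  assume "\<forall>u. \<exists>w. R u w"
  then obtain f where f: "R u (f u)" for u by metis
  have "covered R u (\<Sum>v\<le>u. f v)"
    unfolding covered_def
  proof (intro allI impI)
    fix u' assume "u' < Suc u"
    then have "f u' \<le> (\<Sum>v\<le>u. f v)" by (intro member_le_sum) auto
    then show "\<exists>w'<Suc (\<Sum>v\<le>u. f v). R u' w'" using f le_imp_less_Suc by blast
  qed
  then show ?thesis by blast
qed

lemma infinite_fresh:
  "infinite {t. fresh R (pr1 t) (pr2 t)} \<longleftrightarrow> (\<forall>u. \<exists>w. R u w)"
proof
  let ?T = "{t. fresh R (pr1 t) (pr2 t)}"
  assume inf: "infinite ?T"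
  have unique: "w = w'" if "fresh R u w" "fresh R u w'" for u w w'
    using that unfolding fresh_def by (metis linorder_neqE_nat)
  have "inj_on pr1 ?T"
  proof (rule inj_onI)
    fix s t assume st: "s \<in> ?T" "t \<in> ?T" "pr1 s = pr1 t"
    then have "pr2 s = pr2 t" using unique[of "pr1 t"] by simp
    with st(3) have "prod_decode s = prod_decode t" by (rule prod_eqI)
    then show "s = t" by (metis prod_decode_inverse)
  qed
  then have inf: "infinite (pr1 ` ?T)" using inf finite_imageD by blast
  show "\<forall>u. \<exists>w. R u w"
  proof
    fix u
    obtain t where "t \<in> ?T" "u < pr1 t" using inf unfolding infinite_nat_iff_unbounded by blast
    then have "covered R (pr1 t) (pr2 t)" "u < Suc (pr1 t)" by (simp_all add: fresh_def)
    then show "\<exists>w. R u w" unfolding covered_def by blast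
  qed
next
  assume *: "\<forall>u. \<exists>w. R u w"
  have "\<exists>w. fresh R u w" for u
    using covered_ex[OF *, of u] exists_least_iff[of "covered R u"] unfolding fresh_def by blast
  then obtain f where f: "fresh R u (f u)" for u by metis
  have "range (\<lambda>u. code u (f u)) \<subseteq> {t. fresh R (pr1 t) (pr2 t)}" using f by auto
  moreover have "infinite (range (\<lambda>u. code u (f u)))"
    by (rule range_inj_infinite) (simp add: inj_def)
  ultimately show "infinite {t. fresh R (pr1 t) (pr2 t)}" by (rule infinite_super)
qed

text \<open>The pair \<open>v\<close> codes a candidate for a staircase: the number of entries before the final value, and
  these entries. Whether the candidate is nondecreasing is decided by a bounded search.\<close>

definition coded_stair :: "nat \<Rightarrow> nat \<Rightarrow> baire" where
  "coded_stair m v x = (if x < pr1 v then entry (pr2 v) x else m)"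

definition nondecreasing :: "nat \<Rightarrow> nat \<Rightarrow> bool" where
  "nondecreasing m v \<longleftrightarrow> (\<forall>y<pr1 v. coded_stair m v y \<le> coded_stair m v (Suc y))"

lemma coded_stair_staircase: "nondecreasing m v \<Longrightarrow> coded_stair m v \<in> staircase m"
proof -
  assume nd: "nondecreasing m v"
  have "coded_stair m v y \<le> coded_stair m v (Suc y)" for y
    using nd by (cases "y < pr1 v") (auto simp: nondecreasing_def coded_stair_def)
  moreover have "\<forall>x\<ge>pr1 v. coded_stair m v x = m" by (simp add: coded_stair_def)
  ultimately show ?thesis unfolding staircase_iff mono_iff_le_Suc by blast
qed

lemma staircase_coded_stair:
  assumes "q \<in> staircase m" shows "\<exists>v. nondecreasing m v \<and> q = coded_stair m v"
proof -
  obtain N where q: "mono q" "\<forall>x\<ge>N. q x = m" using assms by (auto simp: staircase_iff)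
  obtain z where "\<forall>i<N. entry z i = q i" using entry_surj by blast
  then have coded: "coded_stair m (code N z) = q" using q(2) by (auto simp: coded_stair_def)
  then have "nondecreasing m (code N z)"
    using q(1) by (simp add: nondecreasing_def mono_iff_le_Suc)
  then show ?thesis using coded by blast
qed

text \<open>The decidable matrix of the \<open>\<Pi>\<^sub>2\<close> condition on \<open>m\<close>, for the instance \<open>r\<close> of the jump. The number
  \<open>u\<close> serves both as a lower bound for a position at which \<open>\<Phi>\<^sub>e(p)\<close> has the value \<open>m\<close>, and as the
  pair of a candidate staircase and an argument at which \<open>\<Phi>\<^sub>i\<close> has to halt; \<open>w\<close> contains one witness
  for each of the two. For \<open>m = n\<close> there is no demand on the values of \<open>\<Phi>\<^sub>e(p)\<close>, since \<open>n\<close> is the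
  level when no smaller number occurs infinitely often.\<close>

definition evidence :: "nat \<Rightarrow> baire \<Rightarrow> nat \<Rightarrow> nat \<Rightarrow> nat \<Rightarrow> bool" where
  "evidence n r m u w \<longleftrightarrow>
    (m < n \<longrightarrow> u \<le> pr1 (pr1 w) \<and> pr1 (pr2 (pr1 w)) = m \<and>
       computation (\<lambda>x. r (x + 2)) (r 0) (pr1 (pr1 w)) (pr2 (pr1 w))) \<and>
    (nondecreasing m (pr1 u) \<longrightarrow>
       computation (pair (\<lambda>x. r (x + 2)) (coded_stair m (pr1 u))) (r 1) (pr2 u) (pr2 w))"

lemma rec_evidence:
  assumes "rec_fun m" "rec_fun u" "rec_fun w"
  shows "rec_rel (\<lambda>p x. evidence n p (m p x) (u p x) (w p x))"
  unfolding evidence_def nondecreasing_def coded_stair_def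
  by (intro rec_intros assms assms[THEN rec_comp])

lemma evidence_iff:
  fixes r :: baire
  defines "p \<equiv> \<lambda>x. r (x + 2)"
  shows "(\<forall>u. \<exists>w. evidence n r m u w) \<longleftrightarrow>
    (m < n \<longrightarrow> (\<forall>u. \<exists>j\<ge>u. eval p (prog_decode (r 0)) j m)) \<and>
    (\<forall>q\<in>staircase m. Phi (r 1) (pair p q) \<noteq> None)"
proof
  assume ev: "\<forall>u. \<exists>w. evidence n r m u w"
  have "\<exists>j\<ge>u. eval p (prog_decode (r 0)) j m" if "m < n" for u
  proof -
    obtain w where "evidence n r m u w" using ev by blast
    then show ?thesis
      using that computation_sound unfolding evidence_def p_def by metis
  qed
  moreover have "\<exists>y. eval (pair p q) (prog_decode (r 1)) x y" if q: "q \<in> staircase m" for q x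
  proof -
    obtain v where v: "nondecreasing m v" "q = coded_stair m v" using staircase_coded_stair[OF q] by blast
    obtain w where "evidence n r m (code v x) w" using ev by blast
    then have "computation (pair p q) (r 1) x (pr2 w)"
      using v by (simp add: evidence_def p_def)
    then show ?thesis using computation_sound by blast
  qed
  ultimately show "(m < n \<longrightarrow> (\<forall>u. \<exists>j\<ge>u. eval p (prog_decode (r 0)) j m)) \<and>
    (\<forall>q\<in>staircase m. Phi (r 1) (pair p q) \<noteq> None)"
    unfolding Phi_neq_None_iff by blast
next
  assume *: "(m < n \<longrightarrow> (\<forall>u. \<exists>j\<ge>u. eval p (prog_decode (r 0)) j m)) \<and>
    (\<forall>q\<in>staircase m. Phi (r 1) (pair p q) \<noteq> None)"
  show "\<forall>u. \<exists>w. evidence n r m u w"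
  proof
    fix u
    have "\<exists>w. m < n \<longrightarrow> u \<le> pr1 w \<and> pr1 (pr2 w) = m \<and> computation p (r 0) (pr1 w) (pr2 w)"
    proof (cases "m < n")
      case True
      then obtain j where j: "u \<le> j" "eval p (prog_decode (r 0)) j m" using * by blast
      obtain w where "computation p (r 0) j w" "pr1 w = m" using computation_complete[OF j(2)] by blast
      then show ?thesis using j(1) by (intro exI[of _ "code j w"]) simp
    qed simp
    then obtain w where w: "m < n \<longrightarrow> u \<le> pr1 w \<and> pr1 (pr2 w) = m \<and>
        computation p (r 0) (pr1 w) (pr2 w)" by blast
    have "\<exists>w. nondecreasing m (pr1 u) \<longrightarrow> computation (pair p (coded_stair m (pr1 u))) (r 1) (pr2 u) w"
      using * coded_stair_staircase[of m "pr1 u"] computation_complete unfolding Phi_neq_None_iff by metis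
    then obtain w' where "nondecreasing m (pr1 u) \<longrightarrow>
        computation (pair p (coded_stair m (pr1 u))) (r 1) (pr2 u) w'" by blast
    then have "evidence n r m u (code w w')" using w by (simp add: evidence_def p_def)
    then show "\<exists>w. evidence n r m u w" by blast
  qed
qed

text \<open>The argument \<open>s\<close> ranges over all triples of a number \<open>m\<close> and a pair to be tested for it; the
  irrelevant value \<open>Suc n\<close> fills the gaps.\<close>

definition announce :: "nat \<Rightarrow> baire \<Rightarrow> baire" where
  "announce n r s =
    (if pr1 s \<le> n \<and> fresh (evidence n r (pr1 s)) (pr1 (pr2 s)) (pr2 (pr2 s)) then pr1 s else Suc n)"

lemma rec_announce: "rec_fun (announce n)"
  unfolding announce_def fresh_def covered_def by (intro rec_intros rec_evidence)

lemma announce_inf: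
  assumes "m \<le> n"
  shows "(\<exists>\<^sub>\<infinity>s. announce n r s = m) \<longleftrightarrow> (\<forall>u. \<exists>w. evidence n r m u w)"
proof -
  have "{s. announce n r s = m} = code m ` {t. fresh (evidence n r m) (pr1 t) (pr2 t)}"
  proof (intro equalityI subsetI)
    fix s assume "s \<in> {s. announce n r s = m}"
    then have "pr1 s = m" "fresh (evidence n r m) (pr1 (pr2 s)) (pr2 (pr2 s))"
      using assms by (auto simp: announce_def split: if_splits)
    moreover have "s = code (pr1 s) (pr2 s)" by simp
    ultimately show "s \<in> code m ` {t. fresh (evidence n r m) (pr1 t) (pr2 t)}" by blast
  qed (use assms in \<open>auto simp: announce_def\<close>)
  moreover have "inj (code m)" by (simp add: inj_def)
  ultimately show ?thesis
    by (simp add: INFM_iff_infinite finite_image_iff inj_on_subset infinite_fresh[symmetric])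
qed

text \<open>A position at which \<open>q\<close> is \<open>Suc n\<close> stops the search as well: it shows that no \<open>m \<le> n\<close> is announced
  infinitely often.\<close>

definition halted :: "nat \<Rightarrow> baire \<Rightarrow> baire \<Rightarrow> nat \<Rightarrow> nat \<Rightarrow> bool" where
  "halted n r q x w \<longleftrightarrow> computation (pair (\<lambda>y. r (y + 2)) q) (r 1) x w \<or> q w = Suc n"

definition answer :: "nat \<Rightarrow> baire \<Rightarrow> baire \<Rightarrow> baire" where
  "answer n r q x = (let w = LEAST w. halted n r q x w in if q w = Suc n then 0 else pr1 w)"

text \<open>Totality holds without the side condition of the jump: if \<open>q\<close> does not reach \<open>Suc n\<close>, its final
  value was announced infinitely often, which was made dependent on the totality of the
  functional on all staircases with this final value.\<close>

lemma answer_total: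
  assumes "q \<in> g_problem (Suc n) (announce n r)" shows "\<exists>w. halted n r q x w"
proof (cases "level (Suc n) (announce n r) = Suc n")
  case True
  then show ?thesis
    using assms staircase_attained unfolding g_problem_level halted_def by metis
next
  case False
  let ?m = "level (Suc n) (announce n r)"
  have m: "?m \<le> n" using False level_le[of "Suc n" "announce n r"] by simp
  then have "\<exists>\<^sub>\<infinity>s. announce n r s = ?m" by (intro level_inf) simp
  then have "Phi (r 1) (pair (\<lambda>x. r (x + 2)) q) \<noteq> None"
    using assms unfolding announce_inf[OF m] evidence_iff g_problem_level by blast
  then obtain y where "Phi (r 1) (pair (\<lambda>x. r (x + 2)) q) = Some y" by blast
  then show ?thesis using computation_exists unfolding halted_def by blast
qed

lemma answer_correct:
  assumes "Phi (r 1) (pair (\<lambda>x. r (x + 2)) q) = Some y" "\<And>x. q x \<le> n"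
  shows "answer n r q = y"
proof
  fix x
  have q: "q w \<noteq> Suc n" for w using assms(2)[of w] by simp
  have "\<exists>w. halted n r q x w" using computation_exists[OF assms(1)] unfolding halted_def by blast
  then have "halted n r q x (LEAST w. halted n r q x w)" by (rule LeastI_ex)
  then have "computation (pair (\<lambda>y. r (y + 2)) q) (r 1) x (LEAST w. halted n r q x w)"
    using q unfolding halted_def by blast
  then show "answer n r q x = y x"
    using computation_value[OF assms(1)] q by (simp add: answer_def Let_def)
qed

text \<open>Under the side condition, the level \<open>m\<close> of \<open>\<Phi>\<^sub>e(p)\<close> is announced infinitely often because the
  functional is total on \<open>staircase m\<close>; smaller numbers are not, because they occur only finitely
  often in \<open>\<Phi>\<^sub>e(p)\<close>.\<close>

lemma level_announce:
  assumes p': "Phi (r 0) (\<lambda>x. r (x + 2)) = Some p'"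
    and total: "\<And>q. q \<in> g_problem n p' \<Longrightarrow> Phi (r 1) (pair (\<lambda>x. r (x + 2)) q) \<noteq> None"
  shows "level (Suc n) (announce n r) = level n p'"
proof (rule antisym)
  have p'_iff: "eval (\<lambda>x. r (x + 2)) (prog_decode (r 0)) j k \<longleftrightarrow> p' j = k" for j k
    using p' eval_deterministic unfolding Phi_eq_Some_iff by metis
  have "level n p' < n \<longrightarrow> (\<forall>u. \<exists>j\<ge>u. p' j = level n p')"
    using level_inf[of n p'] by (simp add: INFM_nat_le)
  then have "\<exists>\<^sub>\<infinity>s. announce n r s = level n p'"
    unfolding announce_inf[OF level_le] evidence_iff p'_iff
    using total unfolding g_problem_level by blast
  then show "level (Suc n) (announce n r) \<le> level n p'" by (rule level_least)
  show "level n p' \<le> level (Suc n) (announce n r)"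
  proof (rule ccontr)
    let ?k = "level (Suc n) (announce n r)"
    assume "\<not> ?thesis"
    then have k: "?k < level n p'" by simp
    then have "?k < n" using level_le[of n p'] by simp
    then have "\<exists>\<^sub>\<infinity>s. announce n r s = ?k" by (intro level_inf) simp
    then have "\<forall>u. \<exists>j\<ge>u. p' j = ?k"
      using \<open>?k < n\<close> announce_inf[of ?k n r] unfolding evidence_iff p'_iff by simp
    then have "level n p' \<le> ?k" by (intro level_least) (simp add: INFM_nat_le)
    then show False using k by simp
  qed
qed

lemma tot_jump_le_g_problem: "tot_jump (g_problem n) \<le>\<^sub>W g_problem (Suc n)"
proof -
  obtain a where a: "\<And>r. functional a r = Some (announce n r)"
    using rec_functional[OF rec_announce] by metis
  have "rec_rel (\<lambda>p z. halted n (left p) (right p) (pr1 z) (pr2 z))"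
    unfolding halted_def by (intro rec_intros)
  moreover have "rec_fun (\<lambda>p z. if right p (pr2 z) = Suc n then 0 else pr1 (pr2 z))"
    by (intro rec_intros)
  ultimately obtain b where b: "\<And>p x w. halted n (left p) (right p) x w \<Longrightarrow>
      eval p b x (answer n (left p) (right p) x)"
    using search[of "\<lambda>p. halted n (left p) (right p)" "\<lambda>p x w. if right p w = Suc n then 0 else pr1 w"]
    unfolding answer_def Let_def by blast
  have "answer n r q \<in> tot_jump (g_problem n) r" if q: "q \<in> g_problem (Suc n) (announce n r)" for r q
  proof (cases "\<exists>p'. Phi (r 0) (\<lambda>x. r (x + 2)) = Some p' \<and> p' \<in> pdom (g_problem n) \<and>
      (\<forall>q\<in>g_problem n p'. Phi (r 1) (pair (\<lambda>x. r (x + 2)) q) \<noteq> None)")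
    case True
    then obtain p' where p': "Phi (r 0) (\<lambda>x. r (x + 2)) = Some p'"
      "\<And>q. q \<in> g_problem n p' \<Longrightarrow> Phi (r 1) (pair (\<lambda>x. r (x + 2)) q) \<noteq> None" by blast
    have "q \<in> g_problem n p'" using q level_announce[OF p'] by (simp add: g_problem_level)
    moreover from this obtain y where y: "Phi (r 1) (pair (\<lambda>x. r (x + 2)) q) = Some y"
      using p'(2) by blast
    moreover have "answer n r q = y"
      using y
    proof (rule answer_correct)
      show "q x \<le> n" for x
        using staircase_le[of q _ x] level_le[of n p'] \<open>q \<in> g_problem n p'\<close>
        unfolding g_problem_level by fastforce
    qed
    moreover have "tot_jump (g_problem n) r =
        {y. \<exists>q\<in>g_problem n p'. Phi (r 1) (pair (\<lambda>x. r (x + 2)) q) = Some y}"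
      unfolding tot_jump_def by (rule tot_jump_at_total[OF p'(1) g_problem_nonempty p'(2)])
    ultimately show ?thesis by blast
  next
    case False
    then have "tot_jump (g_problem n) r = UNIV"
      unfolding tot_jump_def tot_jump_at_def by (rule if_not_P)
    then show ?thesis by simp
  qed
  moreover have "functional b (pair r q) = Some (answer n r q)"
    if "q \<in> g_problem (Suc n) (announce n r)" for r q
    unfolding functional_eq_Some_iff using b[of "pair r q"] answer_total[OF that] by simp blast
  ultimately have "reduces a b (tot_jump (g_problem n)) (g_problem (Suc n))"
    by (intro reducesI[where F = "announce n"] a g_problem_nonempty) blast
  then show ?thesis using weihrauch_le_iff by blast
qed

section \<open>The iterated tot-jump\<close>

lemma g_problem_0: "g_problem 0 p = {\<lambda>_. 0}"
  by (simp add: g_problem_def inf_often_def staircase_def)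

lemma id_equiv_g_problem_0: "id_problem \<equiv>\<^sub>W g_problem 0"
proof -
  have "rec_fun (\<lambda>p x. p x)" "rec_fun left" "rec_fun (\<lambda>p x. 0)" by (intro rec_intros)+
  then obtain a b c where abc: "\<And>p. functional a p = Some p"
    "\<And>p. functional b p = Some (left p)" "\<And>p. functional c p = Some (\<lambda>_. 0)"
    using rec_functional by metis
  have "reduces a b id_problem (g_problem 0)"
    by (rule reducesI[where F = "\<lambda>p. p"]) (simp_all add: abc g_problem_0 id_problem_def)
  moreover have "reduces a c (g_problem 0) id_problem"
    by (rule reducesI[where F = "\<lambda>p. p"]) (simp_all add: abc g_problem_0 id_problem_def)
  ultimately show ?thesis unfolding weihrauch_equiv_def weihrauch_le_iff by blast
qed

theorem theorem4p5:
  fixes n :: nat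
  assumes "n > 0"
  shows "(tot_jump ^^ n) id_problem \<equiv>\<^sub>W g_problem n"
proof -
  have "(tot_jump ^^ n) id_problem \<equiv>\<^sub>W g_problem n" for n
  proof (induction n)
    case 0
    show ?case by (simp add: id_equiv_g_problem_0)
  next
    case (Suc n)
    then have "tot_jump ((tot_jump ^^ n) id_problem) \<le>\<^sub>W tot_jump (g_problem n)"
      "tot_jump (g_problem n) \<le>\<^sub>W tot_jump ((tot_jump ^^ n) id_problem)"
      unfolding weihrauch_equiv_def by (blast intro: tot_jump_mono)+
    then show ?case
      unfolding weihrauch_equiv_def funpow.simps o_apply
      using weihrauch_le_trans tot_jump_le_g_problem g_problem_le_tot_jump by blast
  qed
  then show ?thesis .
qed

end
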